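(* Let $(V,G)$ be an orthogonal representation of a compact Lie group $G$ with nontrivial copolarity, let $\Sigma\subseteq V$ be a fat section of $(V,G)$ with fat Weyl group $W$, and let $\sigma:V\to\Sigma$ be the orthogonal projection. Let $E\subset V$ be a $G$-invariant compact convex set and let $P:=\sigma(E)=E\cap\Sigma$. For a face $Q$ of $P$ set $F_Q:=\sigma^{-1}(Q)\cap E$, which is a face of $E$. Then the map $\mathscr{F}(P)\to\mathscr{F}(E)$, $Q\mapsto F_Q$, induces a bijection between $\mathscr{F}(P)/W$ and $\mathscr{F}(E)/G$.
   Context: An orthogonal representation $(V,G)$ of a compact Lie group $G$ is a continuous homomorphism $G\to O(V)$, where $V$ is a finite-dimensional real vector space with scalar product $\langle\cdot,\cdot\rangle$. A point $p\in V$ is $G$-regular if it lies on a principal orbit. $T_p(G\cdot p)$ denotes the tangent space of the orbit at $p$, and $\nu_p(G\cdot p)$ its orthogonal complement in $V$ (the normal space). A fat section of $(V,G)$ is a subset $\Sigma\subseteq V$ such that: (A) $\Sigma$ is a linear subspace of $V$ that intersects all $G$-orbits; (B) for some fixed integer $k\ge 0$, for all $G$-regular $p\in\Sigma$ we have $\nu_p(G\cdot p)\subseteq T_p\Sigma=\Sigma$ with codimension $k$; (C) for all $G$-regular $p\in\Sigma$ and all $g\in G$ such that $g\cdot p\in\Sigma$, we have $g\cdot\Sigma=\Sigma$. The whole space $V$ is always a fat section; $(V,G)$ has nontrivial copolarity if $V$ is not the unique fat section. The fat Weyl group of $\Sigma$ is $W:=N_G(\Sigma)/Z_G(\Sigma)$,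 where $N_G(\Sigma)=\{g\in G: g\cdot\Sigma=\Sigma\}$ and $Z_G(\Sigma)=\{g\in G: g\cdot x=x\ \text{for all } x\in\Sigma\}$; it acts naturally on $\Sigma$. It is known (Mendes) that for every $G$-invariant convex set $E\subset V$ one has $\sigma(E)=E\cap\Sigma$, which is a $W$-invariant convex subset of $\Sigma$. A face of a compact convex set $C$ is a convex subset $F\subset C$ such that whenever $x,y\in C$ and $\operatorname{relint}[x,y]\cap F\neq\emptyset$, one has $[x,y]\subset F$ (the sets $\emptyset$ and $C$ are faces). $\mathscr{F}(C)$ denotes the set of faces of $C$. $G$ acts on $\mathscr{F}(E)$ and $W$ acts on $\mathscr{F}(P)$ by moving faces. *)

theory Defs
  imports "HOL-Analysis.Analysis" "HOL-Algebra.Group_Action"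
begin

text \<open>
  The charts below take values in the topological space \<^term>\<open>Euclidean_space n\<close>, whose points are
  the real sequences vanishing from index \<open>n\<close> on. This keeps the dimension a natural number and
  includes \<open>n = 0\<close>, so that finite groups are Lie groups.
\<close>

text \<open>Class \<open>C\<^sup>k\<close> on a subset \<open>D\<close> of \<open>n\<close>-space, meaningful only for open \<open>D\<close>.\<close>

primrec Ck_on :: "nat \<Rightarrow> nat \<Rightarrow> (nat \<Rightarrow> real) set \<Rightarrow> ((nat \<Rightarrow> real) \<Rightarrow> real) \<Rightarrow> bool" where
  "Ck_on 0 n D f \<longleftrightarrow> continuous_map (subtopology (Euclidean_space n) D) euclideanreal f"
| "Ck_on (Suc k) n D f \<longleftrightarrow>
     continuous_map (subtopology (Euclidean_space n) D) euclideanreal f \<and>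
     (\<forall>i<n. \<exists>f'. Ck_on k n D f' \<and>
        (\<forall>x\<in>D. ((\<lambda>t. f (x(i := t))) has_real_derivative f' x) (at (x i))))"

definition smooth_between ::
  "nat \<Rightarrow> nat \<Rightarrow> (nat \<Rightarrow> real) set \<Rightarrow> ((nat \<Rightarrow> real) \<Rightarrow> nat \<Rightarrow> real) \<Rightarrow> bool" where
  "smooth_between n m D f \<longleftrightarrow>
     openin (Euclidean_space n) D \<and> f ` D \<subseteq> topspace (Euclidean_space m) \<and>
     (\<forall>k. \<forall>j<m. Ck_on k n D (\<lambda>x. f x j))"

text \<open>
  A chart is a pair \<open>(U, \<phi>)\<close> of a domain and a coordinate map. The atlas need not be maximal; it
  determines a maximal one.
\<close>

definition smooth_manifold ::
  "'a topology \<Rightarrow> nat \<Rightarrow> ('a set \<times> ('a \<Rightarrow> nat \<Rightarrow> real)) set \<Rightarrow> bool" where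
  "smooth_manifold T n A \<longleftrightarrow>
     Hausdorff_space T \<and> second_countable T \<and>
     \<Union>(fst ` A) = topspace T \<and>
     (\<forall>(U, \<phi>)\<in>A. openin T U \<and> openin (Euclidean_space n) (\<phi> ` U) \<and>
        homeomorphic_map (subtopology T U) (subtopology (Euclidean_space n) (\<phi> ` U)) \<phi>) \<and>
     (\<forall>(U, \<phi>)\<in>A. \<forall>(U', \<phi>')\<in>A.
        smooth_between n n (\<phi> ` (U \<inter> U')) (\<lambda>x. \<phi>' (inv_into U \<phi> x)))"

text \<open>The identification of \<open>(n+n)\<close>-space with the square of \<open>n\<close>-space.\<close>

definition left_half :: "nat \<Rightarrow> (nat \<Rightarrow> real) \<Rightarrow> nat \<Rightarrow> real" where
  "left_half n z = (\<lambda>i. if i < n then z i else 0)"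

definition right_half :: "nat \<Rightarrow> (nat \<Rightarrow> real) \<Rightarrow> nat \<Rightarrow> real" where
  "right_half n z = (\<lambda>i. z (n + i))"

text \<open>
  Smoothness of multiplication and inversion is expressed in charts. As \<^const>\<open>smooth_between\<close>
  requires an open domain, the two conditions include continuity of the group operations.
\<close>

definition lie_group ::
  "('g, 'm) monoid_scheme \<Rightarrow> 'g topology \<Rightarrow> nat \<Rightarrow> ('g set \<times> ('g \<Rightarrow> nat \<Rightarrow> real)) set \<Rightarrow> bool" where
  "lie_group G T n A \<longleftrightarrow>
     group G \<and> topspace T = carrier G \<and> smooth_manifold T n A \<and>
     (\<forall>(U, \<phi>)\<in>A. \<forall>(U', \<phi>')\<in>A. \<forall>(U'', \<phi>'')\<in>A.
        smooth_between (n + n) n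
          {z \<in> topspace (Euclidean_space (n + n)).
             left_half n z \<in> \<phi> ` U \<and> right_half n z \<in> \<phi>' ` U' \<and>
             inv_into U \<phi> (left_half n z) \<otimes>\<^bsub>G\<^esub> inv_into U' \<phi>' (right_half n z) \<in> U''}
          (\<lambda>z. \<phi>'' (inv_into U \<phi> (left_half n z) \<otimes>\<^bsub>G\<^esub> inv_into U' \<phi>' (right_half n z)))) \<and>
     (\<forall>(U, \<phi>)\<in>A. \<forall>(U', \<phi>')\<in>A.
        smooth_between n n
          {x \<in> \<phi> ` U. inv\<^bsub>G\<^esub> (inv_into U \<phi> x) \<in> U'}
          (\<lambda>x. \<phi>' (inv\<^bsub>G\<^esub> (inv_into U \<phi> x))))"

definition compact_lie_group ::
  "('g, 'm) monoid_scheme \<Rightarrow> 'g topology \<Rightarrow> nat \<Rightarrow> ('g set \<times> ('g \<Rightarrow> nat \<Rightarrow> real)) set \<Rightarrow> bool" where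
  "compact_lie_group G T n A \<longleftrightarrow> lie_group G T n A \<and> compact_space T"

text \<open>
  The space \<open>V\<close> is the type \<open>'v\<close>. The type class \<open>euclidean_space\<close> leaves out only the
  zero space, whose representations have no nontrivial copolarity.
\<close>

definition orthogonal_group :: "('v::euclidean_space \<Rightarrow>\<^sub>L 'v) monoid" where
  "orthogonal_group =
     \<lparr>carrier = {f. orthogonal_transformation (blinfun_apply f)},
      monoid.mult = (o\<^sub>L), one = id_blinfun\<rparr>"

definition orthogonal_representation ::
  "('g, 'm) monoid_scheme \<Rightarrow> 'g topology \<Rightarrow> ('g \<Rightarrow> 'v::euclidean_space \<Rightarrow>\<^sub>L 'v) \<Rightarrow> bool" where
  "orthogonal_representation G T \<rho> \<longleftrightarrow>
     \<rho> \<in> hom G orthogonal_group \<and> continuous_map T euclidean \<rho>"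

abbreviation act :: "('g \<Rightarrow> 'v::euclidean_space \<Rightarrow>\<^sub>L 'v) \<Rightarrow> 'g \<Rightarrow> 'v \<Rightarrow> 'v" where
  "act \<rho> g \<equiv> blinfun_apply (\<rho> g)"

abbreviation act_set :: "('g \<Rightarrow> 'v::euclidean_space \<Rightarrow>\<^sub>L 'v) \<Rightarrow> 'g \<Rightarrow> 'v set \<Rightarrow> 'v set" where
  "act_set \<rho> g S \<equiv> act \<rho> g ` S"

text \<open>
  The principal orbits are those of maximal orbit type: the isotropy group of \<open>p\<close> is conjugate to a
  subgroup of every isotropy group.
\<close>

definition regular_point ::
  "('g, 'm) monoid_scheme \<Rightarrow> ('g \<Rightarrow> 'v::euclidean_space \<Rightarrow>\<^sub>L 'v) \<Rightarrow> 'v \<Rightarrow> bool" where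
  "regular_point G \<rho> p \<longleftrightarrow>
     (\<forall>q. \<exists>g\<in>carrier G.
        (\<lambda>h. g \<otimes>\<^bsub>G\<^esub> h \<otimes>\<^bsub>G\<^esub> inv\<^bsub>G\<^esub> g) ` stabilizer G (act \<rho>) p \<subseteq> stabilizer G (act \<rho>) q)"

text \<open>
  Tangent vectors are velocities of smooth curves lying in \<open>S\<close>; the sequence \<open>c\<close> consists of the
  curve \<open>c 0\<close> and its successive derivatives. This is the tangent space when \<open>S\<close> is an embedded
  submanifold, such as an orbit.
\<close>

definition tangent_space :: "'v::euclidean_space set \<Rightarrow> 'v \<Rightarrow> 'v set" where
  "tangent_space S p =
     {v. \<exists>c :: nat \<Rightarrow> real \<Rightarrow> 'v.
        (\<forall>k t. (c k has_vector_derivative c (Suc k) t) (at t)) \<and>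
        (\<forall>t. c 0 t \<in> S) \<and> c 0 0 = p \<and> c 1 0 = v}"

definition normal_space :: "'v::euclidean_space set \<Rightarrow> 'v \<Rightarrow> 'v set" where
  "normal_space S p = orthogonal_comp (tangent_space S p)"

definition fat_section ::
  "('g, 'm) monoid_scheme \<Rightarrow> ('g \<Rightarrow> 'v::euclidean_space \<Rightarrow>\<^sub>L 'v) \<Rightarrow> 'v set \<Rightarrow> bool" where
  "fat_section G \<rho> \<Sigma> \<longleftrightarrow>
     (subspace \<Sigma> \<and> (\<forall>p. orbit G (act \<rho>) p \<inter> \<Sigma> \<noteq> {})) \<and>
     (\<exists>k::nat. \<forall>p\<in>\<Sigma>. regular_point G \<rho> p \<longrightarrow>
        normal_space (orbit G (act \<rho>) p) p \<subseteq> \<Sigma> \<and>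
        dim \<Sigma> = dim (normal_space (orbit G (act \<rho>) p) p) + k) \<and>
     (\<forall>p\<in>\<Sigma>. regular_point G \<rho> p \<longrightarrow>
        (\<forall>g\<in>carrier G. act \<rho> g p \<in> \<Sigma> \<longrightarrow> act_set \<rho> g \<Sigma> = \<Sigma>))"

definition nontrivial_copolarity ::
  "('g, 'm) monoid_scheme \<Rightarrow> ('g \<Rightarrow> 'v::euclidean_space \<Rightarrow>\<^sub>L 'v) \<Rightarrow> bool" where
  "nontrivial_copolarity G \<rho> \<longleftrightarrow> \<not> (\<forall>\<Sigma>. fat_section G \<rho> \<Sigma> \<longrightarrow> \<Sigma> = UNIV)"

definition set_normalizer ::
  "('g, 'm) monoid_scheme \<Rightarrow> ('g \<Rightarrow> 'v::euclidean_space \<Rightarrow>\<^sub>L 'v) \<Rightarrow> 'v set \<Rightarrow> 'g set" where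
  "set_normalizer G \<rho> \<Sigma> = {g \<in> carrier G. act_set \<rho> g \<Sigma> = \<Sigma>}"

definition set_centralizer ::
  "('g, 'm) monoid_scheme \<Rightarrow> ('g \<Rightarrow> 'v::euclidean_space \<Rightarrow>\<^sub>L 'v) \<Rightarrow> 'v set \<Rightarrow> 'g set" where
  "set_centralizer G \<rho> \<Sigma> = {g \<in> carrier G. \<forall>x\<in>\<Sigma>. act \<rho> g x = x}"

definition fat_weyl_group ::
  "('g, 'm) monoid_scheme \<Rightarrow> ('g \<Rightarrow> 'v::euclidean_space \<Rightarrow>\<^sub>L 'v) \<Rightarrow> 'v set \<Rightarrow> 'g set monoid" where
  "fat_weyl_group G \<rho> \<Sigma> =
     (G\<lparr>carrier := set_normalizer G \<rho> \<Sigma>\<rparr>) Mod (set_centralizer G \<rho> \<Sigma>)"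

text \<open>
  An element of the fat Weyl group is a coset \<open>w\<close>, all of whose members act in the same way on
  \<open>\<Sigma>\<close>. For a subset \<open>Q\<close> of \<open>\<Sigma>\<close> the following is therefore the image of \<open>Q\<close> under \<open>w\<close>.
\<close>

definition weyl_act_set ::
  "('g \<Rightarrow> 'v::euclidean_space \<Rightarrow>\<^sub>L 'v) \<Rightarrow> 'g set \<Rightarrow> 'v set \<Rightarrow> 'v set" where
  "weyl_act_set \<rho> w Q = (\<Union>g\<in>w. act_set \<rho> g Q)"

definition orthogonal_projection :: "'v::euclidean_space set \<Rightarrow> 'v \<Rightarrow> 'v" where
  "orthogonal_projection \<Sigma> x = (THE y. y \<in> \<Sigma> \<and> x - y \<in> orthogonal_comp \<Sigma>)"

definition faces :: "'v::euclidean_space set \<Rightarrow> 'v set set" where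
  "faces C = {F. F face_of C}"

definition lifted_face :: "'v::euclidean_space set \<Rightarrow> 'v set \<Rightarrow> 'v set \<Rightarrow> 'v set" where
  "lifted_face \<Sigma> E Q = orthogonal_projection \<Sigma> -` Q \<inter> E"

end

theory Submission
  imports Defs "HOL-Real_Asymp.Real_Asymp"
begin

text \<open>
  Only the compact group \<open>K\<close> of orthogonal maps induced by \<open>G\<close> matters. A pair \<open>(w, x)\<close> is
  called maximal if \<open>w \<bullet> k x \<le> w \<bullet> x\<close> for all \<open>k\<close> in \<open>K\<close>, that is, if \<open>x\<close> is a point of its orbit
  closest to \<open>w\<close>; then \<open>w\<close> is normal to the orbit of \<open>x\<close>. Such pairs show that regular points
  exist and are dense in \<open>\<Sigma>\<close>. Maximizing a functional \<open>p\<close> in \<open>\<Sigma>\<close> over an orbit therefore gives a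
  point of \<open>\<Sigma>\<close>, whence \<open>\<sigma>(E) = E \<inter> \<Sigma>\<close>, and two points of \<open>\<Sigma>\<close> on one \<open>K\<close>-orbit lie on one
  orbit of the normalizer of \<open>\<Sigma>\<close>.

  For \<open>v\<close> in \<open>\<Sigma>\<close> these properties are inherited by the isotropy group of \<open>v\<close> acting on the normal
  space of the orbit of \<open>v\<close>, which contains the face of \<open>E\<close> exposed by \<open>v\<close>. By induction on the
  dimension every face of \<open>E\<close>, exposed or not, can be moved to one of the form \<open>F\<^sub>Q\<close>.
\<close>

section \<open>Compact groups of orthogonal maps and regular points\<close>

text \<open>Orbits are handled metrically: \<open>w\<close> is normal at \<open>y\<close> if
  \<open>(k y - y) \<bullet> w\<close> is of second order in the displacement
  \<open>k y - y\<close>. The estimates rest on two facts. Orbits lie on spheres, so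
  \<open>(k y - y) \<bullet> y\<close> is exactly minus half the squared displacement; and
  compactness of \<open>K\<close> realizes each displacement by an element whose distance to the
  identity is comparable to it.

  The conditions of a fat section speak of regular points, and regularity for \<open>K\<close> is a
  different notion from regularity for an isotropy group. The induction therefore carries two
  statements about all orbits in an invariant subspace: a functional in \<Sigma> has a maximizer in
  \<Sigma>, and the projection of a point lies in the convex hull of its orbit. Both come down to
  the isotropy group of \<open>v\<close> by testing points \<open>v + \<delta> y\<close> with small
  \<delta>.

  The induction also yields that every orbit meeting the moved face meets it inside \<Sigma>. This
  extra information is what gives injectivity on orbits of faces.\<close>

locale compact_orthogonal_group =
  fixes K :: "('v::euclidean_space \<Rightarrow>\<^sub>L 'v) set"
  assumes compact_K: "compact K"
    and id_K: "id_blinfun \<in> K"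
    and compose_K: "\<lbrakk>k \<in> K; l \<in> K\<rbrakk> \<Longrightarrow> k o\<^sub>L l \<in> K"
    and inverse_K: "k \<in> K \<Longrightarrow> \<exists>l\<in>K. l o\<^sub>L k = id_blinfun \<and> k o\<^sub>L l = id_blinfun"
    and orthogonal_K: "k \<in> K \<Longrightarrow> orthogonal_transformation (blinfun_apply k)"
begin

lemma inner_K: "k \<in> K \<Longrightarrow> k x \<bullet> k y = x \<bullet> y"
  using orthogonal_K by (auto simp: orthogonal_transformation_def)

lemma norm_apply_K: "k \<in> K \<Longrightarrow> norm (k x) = norm x"
  by (simp add: inner_K norm_eq_sqrt_inner)

lemma inverse_apply_K:
  assumes "k \<in> K"
  shows "\<exists>l\<in>K. l o\<^sub>L k = id_blinfun \<and> k o\<^sub>L l = id_blinfun \<and>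
    (\<forall>x. l (k x) = x) \<and> (\<forall>x. k (l x) = x) \<and> (\<forall>x y. x \<bullet> k y = l x \<bullet> y)"
proof -
  obtain l where l: "l \<in> K" "l o\<^sub>L k = id_blinfun" "k o\<^sub>L l = id_blinfun"
    using inverse_K[OF assms] by blast
  have 1: "l (k x) = x" "k (l x) = x" for x
    using arg_cong[OF l(2), of "\<lambda>f. f x"] arg_cong[OF l(3), of "\<lambda>f. f x"] by simp_all
  have 2: "x \<bullet> k y = l x \<bullet> y" for x y
    using inner_K[OF l(1), of x "k y"] 1 by simp
  show ?thesis using l 1 2 by blast
qed

lemma norm_le_1_K: "k \<in> K \<Longrightarrow> norm k \<le> 1"
  by (rule norm_blinfun_bound) (auto simp: norm_apply_K)

text \<open>Both points lie on one sphere about the origin. This exact second-order loss is what the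
  error terms of all later estimates are weighed against.\<close>

lemma displacement_inner: "k \<in> K \<Longrightarrow> (k x - x) \<bullet> x = - (norm (k x - x))\<^sup>2 / 2"
  by (simp add: power2_norm_eq_inner inner_K inner_diff inner_commute)

definition stab :: "'v \<Rightarrow> ('v \<Rightarrow>\<^sub>L 'v) set" where
  "stab x = {k \<in> K. k x = x}"

definition maximal_pair :: "'v \<Rightarrow> 'v \<Rightarrow> bool" where
  "maximal_pair w x \<longleftrightarrow> (\<forall>k\<in>K. w \<bullet> k x \<le> w \<bullet> x)"

lemma maximal_pair_commute: "maximal_pair w x \<longleftrightarrow> maximal_pair x w"
proof -
  have "maximal_pair x w" if "maximal_pair w x" for w x
    unfolding maximal_pair_def
  proof
    fix k assume "k \<in> K"
    then obtain l where "l \<in> K" "x \<bullet> k w = l x \<bullet> w"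
      using inverse_apply_K by blast
    then show "x \<bullet> k w \<le> x \<bullet> w"
      using that by (simp add: maximal_pair_def inner_commute)
  qed
  then show ?thesis by blast
qed

lemma compact_orbit_K: "compact ((\<lambda>k. blinfun_apply k x) ` K)"
  by (intro compact_continuous_image compact_K continuous_intros)

lemma maximal_pair_exists: "\<exists>g\<in>K. maximal_pair w (g x)"
proof -
  have "compact ((\<lambda>k. w \<bullet> blinfun_apply k x) ` K)"
    by (intro compact_continuous_image compact_K continuous_intros)
  then obtain g where g: "g \<in> K" "\<forall>k\<in>K. w \<bullet> k x \<le> w \<bullet> g x"
    using id_K compact_attains_sup[of "(\<lambda>k. w \<bullet> blinfun_apply k x) ` K"] by auto
  have "w \<bullet> k (g x) \<le> w \<bullet> g x" if "k \<in> K" for k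
    using bspec[OF g(2) compose_K[OF that g(1)]] by simp
  then show ?thesis using g(1) by (auto simp: maximal_pair_def)
qed

lemma maximal_pair_norm_le:
  assumes "maximal_pair w x" "k \<in> K"
  shows "norm (w - x) \<le> norm (w - k x)"
proof -
  have "(norm (w - x))\<^sup>2 \<le> (norm (w - k x))\<^sup>2"
    using assms inner_K[OF assms(2), of x x]
    by (auto simp: maximal_pair_def power2_norm_eq_inner inner_diff inner_commute)
  then show ?thesis by (simp add: power2_le_iff_abs_le)
qed

text \<open>Kleiner's lemma.\<close>

lemma stab_minimal_segment:
  assumes max: "maximal_pair p q" and t: "0 < t" "t < 1"
  shows "stab ((1 - t) *\<^sub>R q + t *\<^sub>R p) \<subseteq> stab p \<inter> stab q"
proof
  fix k assume k: "k \<in> stab ((1 - t) *\<^sub>R q + t *\<^sub>R p)"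
  then have kK: "k \<in> K" by (simp add: stab_def)
  define z where "z = (1 - t) *\<^sub>R q + t *\<^sub>R p"
  have kz: "k z = z" using k by (simp add: stab_def z_def)
  have le: "p \<bullet> k q \<le> p \<bullet> q" using max kK by (simp add: maximal_pair_def)
  \<comment> \<open>Since \<open>k\<close> fixes \<open>z\<close>, any loss in
    \<open>p \<bullet> k q\<close> must be balanced by a gain in \<open>q \<bullet> k q\<close>. No
    gain over \<open>q \<bullet> q\<close> is possible on a sphere, so \<open>k\<close> fixes
    \<open>q\<close>.\<close>
  have "z \<bullet> k q = z \<bullet> q" using inner_K[OF kK, of z q] kz by simp
  then have "(1 - t) * (q \<bullet> k q - q \<bullet> q) = t * (p \<bullet> q - p \<bullet> k q)"
    by (simp add: z_def inner_add_left algebra_simps)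
  also have "\<dots> \<ge> 0" using le t by simp
  finally have "q \<bullet> k q \<ge> q \<bullet> q" using t by (simp add: zero_le_mult_iff)
  moreover have "(k q - q) \<bullet> q = q \<bullet> k q - q \<bullet> q"
    by (simp add: inner_diff_left inner_commute[of "k q"])
  ultimately have "(norm (k q - q))\<^sup>2 \<le> 0"
    using displacement_inner[OF kK, of q] by linarith
  then have kq: "k q = q" by simp
  have "t *\<^sub>R k p = t *\<^sub>R p"
    using kz kq by (simp add: z_def blinfun.add_right blinfun.scaleR_right)
  then show "k \<in> stab p \<inter> stab q" using kq kK t by (simp add: stab_def)
qed

text \<open>Moving \<open>q\<close> by \<open>g\<close> conjugates its isotropy group, so this is
  maximality of the orbit type without conjugations.\<close>

definition regular :: "'v \<Rightarrow> bool" where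
  "regular p \<longleftrightarrow> (\<forall>q. \<exists>g\<in>K. stab p \<subseteq> stab (g q))"

lemma regular_mono: "\<lbrakk>regular p; stab z \<subseteq> stab p\<rbrakk> \<Longrightarrow> regular z"
  unfolding regular_def by (meson order_trans)

lemma regular_apply:
  assumes "regular p" "k \<in> K"
  shows "regular (k p)"
  unfolding regular_def
proof
  fix q
  obtain g where g: "g \<in> K" "stab p \<subseteq> stab (g q)"
    using assms(1) by (auto simp: regular_def)
  obtain l where l: "l \<in> K" "\<And>x. l (k x) = x" "\<And>x. k (l x) = x"
    using inverse_apply_K[OF assms(2)] by blast
  have "stab (k p) \<subseteq> stab ((k o\<^sub>L g) q)"
  proof
    fix h assume h: "h \<in> stab (k p)"
    have "l o\<^sub>L h o\<^sub>L k \<in> stab p"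
      using h l assms(2) by (auto simp: stab_def intro: compose_K)
    then have "l (h (k (g q))) = g q" using g(2) by (auto simp: stab_def)
    then have "k (l (h (k (g q)))) = k (g q)" by simp
    then have "h (k (g q)) = k (g q)" using l(3) by simp
    then show "h \<in> stab ((k o\<^sub>L g) q)" using h by (simp add: stab_def)
  qed
  then show "\<exists>g\<in>K. stab (k p) \<subseteq> stab (g q)"
    using compose_K[OF assms(2) g(1)] by blast
qed

definition fixed_space :: "'v \<Rightarrow> 'v set" where
  "fixed_space p = {x. \<forall>k\<in>stab p. k x = x}"

lemma subspace_fixed_space: "subspace (fixed_space p)"
  by (auto simp: fixed_space_def subspace_def blinfun.add_right blinfun.scaleR_right)

text \<open>
  Shrinking an isotropy group enlarges its space of fixed points, and strictly so if the isotropy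
  group shrinks strictly. Hence a point with a fixed space of largest dimension has minimal isotropy.
\<close>

lemma regular_exists: "\<exists>p. regular p"
proof -
  obtain p where p: "\<forall>q. dim (fixed_space q) \<le> dim (fixed_space p)"
    using ex_has_greatest_nat[of "\<lambda>_. True" 0 "\<lambda>q. dim (fixed_space q)" "DIM('v) + 1"]
    by (auto simp: le_imp_less_Suc dim_subset_UNIV)
  have minimal: "stab z = stab p" if "stab z \<subseteq> stab p" for z
  proof -
    have sub: "fixed_space p \<subseteq> fixed_space z" using that by (auto simp: fixed_space_def)
    have "fixed_space p = fixed_space z"
      using subspace_dim_equal[OF subspace_fixed_space subspace_fixed_space sub] p by blast
    moreover have "z \<in> fixed_space z" by (simp add: fixed_space_def stab_def)
    ultimately have "z \<in> fixed_space p" by simp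
    then show ?thesis using that by (auto simp: fixed_space_def stab_def)
  qed
  have "regular p" unfolding regular_def
  proof
    fix q
    obtain g where g: "g \<in> K" "maximal_pair p (g q)" using maximal_pair_exists by blast
    have "stab ((1 - 1/2) *\<^sub>R g q + (1/2) *\<^sub>R p) \<subseteq> stab p \<inter> stab (g q)"
      by (rule stab_minimal_segment) (use g in auto)
    then show "\<exists>g\<in>K. stab p \<subseteq> stab (g q)" using g(1) minimal by blast
  qed
  then show ?thesis by blast
qed

section \<open>Short coset representatives\<close>

lemma power_in_K:
  assumes "k \<in> K"
  shows "((\<lambda>l. k o\<^sub>L l) ^^ n) id_blinfun \<in> K"
  by (induction n) (auto simp: id_K intro: compose_K assms)

lemma norm_power_minus_id:
  assumes "k \<in> K"
  shows "norm (((\<lambda>l. k o\<^sub>L l) ^^ n) id_blinfun - id_blinfun) \<le> n * norm (k - id_blinfun)"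
proof (induction n)
  case (Suc n)
  let ?P = "((\<lambda>l. k o\<^sub>L l) ^^ n) id_blinfun"
  have "(k o\<^sub>L ?P) - id_blinfun = (k o\<^sub>L (?P - id_blinfun)) + (k - id_blinfun)"
    by (rule blinfun_eqI) (simp add: blinfun.diff_left blinfun.add_left blinfun.diff_right algebra_simps)
  moreover have "norm (k o\<^sub>L (?P - id_blinfun)) \<le> n * norm (k - id_blinfun)"
    using norm_blinfun_compose[of k "?P - id_blinfun"] Suc
      mult_right_mono[OF norm_le_1_K[OF assms] norm_ge_zero[of "?P - id_blinfun"]] by linarith
  ultimately show ?case
    using norm_triangle_ineq[of "k o\<^sub>L (?P - id_blinfun)" "k - id_blinfun"]
    by (simp add: algebra_simps)
qed simp

text \<open>One more factor \<open>k\<close> adds \<open>k - id_blinfun\<close> up to a product of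
  two deviations. This does the work of an exponential map: powers of elements close to the identity
  follow a straight line up to a quadratic error.\<close>

lemma norm_power_minus_linear:
  assumes "k \<in> K"
  shows "norm (((\<lambda>l. k o\<^sub>L l) ^^ n) id_blinfun - id_blinfun - real n *\<^sub>R (k - id_blinfun))
    \<le> (n * norm (k - id_blinfun))\<^sup>2"
proof (induction n)
  case (Suc n)
  let ?P = "((\<lambda>l. k o\<^sub>L l) ^^ n) id_blinfun" and ?a = "norm (k - id_blinfun)"
  have "(k o\<^sub>L ?P) - id_blinfun - real (Suc n) *\<^sub>R (k - id_blinfun) =
      (?P - id_blinfun - real n *\<^sub>R (k - id_blinfun)) + ((k - id_blinfun) o\<^sub>L (?P - id_blinfun))"
    by (rule blinfun_eqI)
      (simp add: blinfun.diff_left blinfun.add_left blinfun.diff_right blinfun.scaleR_left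
        algebra_simps)
  moreover have "norm ((k - id_blinfun) o\<^sub>L (?P - id_blinfun)) \<le> ?a * (n * ?a)"
    by (rule order_trans[OF norm_blinfun_compose])
      (intro mult_left_mono norm_power_minus_id assms norm_ge_zero)
  ultimately have "norm ((k o\<^sub>L ?P) - id_blinfun - real (Suc n) *\<^sub>R (k - id_blinfun))
      \<le> (n * ?a)\<^sup>2 + ?a * (n * ?a)"
    using Suc norm_triangle_ineq by (smt (verit))
  also have "\<dots> \<le> (Suc n * ?a)\<^sup>2"
    by (simp add: power2_eq_square algebra_simps)
  finally show ?case by simp
qed simp

lemma norm_power_apply_minus:
  assumes "k \<in> K"
  shows "norm (blinfun_apply (((\<lambda>l. k o\<^sub>L l) ^^ n) id_blinfun) y - y) \<le> real n * norm (k y - y)"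
proof (induction n)
  case (Suc n)
  let ?P = "((\<lambda>l. k o\<^sub>L l) ^^ n) id_blinfun"
  have "(k o\<^sub>L ?P) y - y = k (?P y - y) + (k y - y)"
    by (simp add: blinfun.diff_right)
  then have "norm ((k o\<^sub>L ?P) y - y) \<le> norm (k (?P y - y)) + norm (k y - y)"
    by (metis norm_triangle_ineq)
  also have "\<dots> \<le> real n * norm (k y - y) + norm (k y - y)"
    using Suc norm_apply_K[OF assms, of "?P y - y"] by linarith
  finally show ?case by (simp add: algebra_simps)
qed simp

lemma minimal_coset_representative:
  assumes "g \<in> K"
  shows "\<exists>h\<in>K. blinfun_apply h y = g y \<and>
    (\<forall>h'\<in>K. blinfun_apply h' y = g y \<longrightarrow> norm (h - id_blinfun) \<le> norm (h' - id_blinfun))"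
proof -
  have "closed {h. blinfun_apply h y = blinfun_apply g y}"
    by (intro closed_Collect_eq continuous_intros)
  then have "compact (K \<inter> {h. blinfun_apply h y = blinfun_apply g y})"
    using compact_K compact_Int_closed by blast
  moreover have "g \<in> K \<inter> {h. blinfun_apply h y = blinfun_apply g y}" using assms by simp
  moreover have "continuous_on (K \<inter> {h. blinfun_apply h y = blinfun_apply g y}) (\<lambda>h. norm (h - id_blinfun))"
    by (intro continuous_intros)
  ultimately have "\<exists>h\<in>K \<inter> {h. blinfun_apply h y = blinfun_apply g y}.
      \<forall>h'\<in>K \<inter> {h. blinfun_apply h y = blinfun_apply g y}. norm (h - id_blinfun) \<le> norm (h' - id_blinfun)"
    by (intro continuous_attains_inf) auto
  then show ?thesis by blast
qed

text \<open>
  The orbit of \<open>y\<close> is bi-Lipschitz to the homogeneous space of \<open>K\<close> by the isotropy group of \<open>y\<close>.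
  If not, there are shortest coset representatives \<open>h\<^sub>n\<close> tending to the identity in a direction \<open>X\<close>
  whose powers approximate elements \<open>l\<close> of the isotropy group with \<open>l = 1 + s X + O(s\<^sup>2)\<close>; removing
  such an \<open>l\<close> from some \<open>h\<^sub>m\<close> makes it shorter.
\<close>

lemma orbit_lipschitz_representative:
  "\<exists>C\<ge>0. \<forall>g\<in>K. \<exists>h\<in>K. blinfun_apply h y = blinfun_apply g y \<and>
    norm (h - id_blinfun) \<le> C * norm (g y - y)"
proof (rule ccontr)
  assume neg: "\<not> ?thesis"
  have "\<exists>h. h \<in> K \<and> norm (h - id_blinfun) > real n * norm (blinfun_apply h y - y) \<and>
      (\<forall>h'\<in>K. blinfun_apply h' y = blinfun_apply h y \<longrightarrow> norm (h - id_blinfun) \<le> norm (h' - id_blinfun))" for n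
  proof -
    obtain g where g: "g \<in> K"
      "\<forall>h\<in>K. blinfun_apply h y = blinfun_apply g y \<longrightarrow>
        \<not> norm (h - id_blinfun) \<le> real n * norm (g y - y)"
      using neg of_nat_0_le_iff[of n] by blast
    obtain h where "h \<in> K" "blinfun_apply h y = blinfun_apply g y"
      "\<forall>h'\<in>K. blinfun_apply h' y = blinfun_apply g y \<longrightarrow> norm (h - id_blinfun) \<le> norm (h' - id_blinfun)"
      using minimal_coset_representative[OF g(1)] by blast
    then show ?thesis using g(2) by (intro exI[of _ h]) auto
  qed
  then obtain f where f: "\<And>n. f n \<in> K"
    "\<And>n. norm (f n - id_blinfun) > real n * norm (blinfun_apply (f n) y - y)"
    "\<And>n h. \<lbrakk>h \<in> K; blinfun_apply h y = blinfun_apply (f n) y\<rbrakk> \<Longrightarrow> norm (f n - id_blinfun) \<le> norm (h - id_blinfun)"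
    by metis
  define t where "t n = norm (f n - id_blinfun)" for n
  have t_pos: "t n > 0" for n
    using f(2)[of n] mult_nonneg_nonneg[OF of_nat_0_le_iff[of n] norm_ge_zero[of "f n y - y"]]
    unfolding t_def by linarith
  have t_y: "real n * norm (blinfun_apply (f n) y - y) \<le> t n" for n
    using f(2)[of n] by (simp add: t_def)
  \<comment> \<open>Dividing \<open>f n\<close> by an isotropy element leaves its coset unchanged,
    so no isotropy element is closer to \<open>f n\<close> than the identity is.\<close>
  have shorter: "t n \<le> norm (f n - l)" if l: "l \<in> K" "l y = y" for n l
  proof -
    obtain l' where l': "l' \<in> K" "l o\<^sub>L l' = id_blinfun" "\<forall>x. blinfun_apply l' (blinfun_apply l x) = x"
      using inverse_apply_K[OF l(1)] by blast
    have "(f n o\<^sub>L l') y = f n y" using l'(3) l(2) by (metis blinfun_apply_blinfun_compose)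
    then have "t n \<le> norm ((f n o\<^sub>L l') - id_blinfun)"
      unfolding t_def using f(3) compose_K[OF f(1) l'(1)] by blast
    also have "(f n o\<^sub>L l') - id_blinfun = ((f n - l) o\<^sub>L l')"
      by (subst l'(2)[symmetric]) (rule blinfun_eqI, simp add: blinfun.diff_left)
    also have "norm \<dots> \<le> norm (f n - l)"
      using norm_blinfun_compose[of "f n - l" l'] norm_le_1_K[OF l'(1)]
        mult_left_le[of "norm l'" "norm (f n - l)"] by simp
    finally show ?thesis .
  qed
  define X where "X n = (1 / t n) *\<^sub>R (f n - id_blinfun)" for n
  have norm_X: "norm (X n) = 1" for n
    using t_pos[of n] by (simp add: X_def t_def)
  have f_X: "f n = id_blinfun + t n *\<^sub>R X n" for n
    using t_pos[of n] by (simp add: X_def)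
  obtain f0 r1 where r1: "f0 \<in> K" "strict_mono r1" "(f \<circ> r1) \<longlonglongrightarrow> f0"
    using compact_K f(1) unfolding compact_def by blast
  have "compact (cball 0 1 :: ('v \<Rightarrow>\<^sub>L 'v) set)" by (rule compact_cball)
  moreover have "\<forall>n. (X \<circ> r1) n \<in> cball 0 1" using norm_X by simp
  ultimately obtain X0 r2 where r2: "strict_mono r2" "(X \<circ> r1 \<circ> r2) \<longlonglongrightarrow> X0"
    unfolding compact_def by blast
  define r where "r = r1 \<circ> r2"
  have r: "strict_mono r" unfolding r_def using r1(2) r2(1) by (rule strict_mono_o)
  have rn: "n \<le> r n" for n using r by (rule seq_suble)
  have lim_f: "(\<lambda>n. f (r n)) \<longlonglongrightarrow> f0"
    using LIMSEQ_subseq_LIMSEQ[OF r1(3) r2(1)] by (simp add: r_def o_def)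
  have lim_X: "(\<lambda>n. X (r n)) \<longlonglongrightarrow> X0" using r2(2) by (simp add: r_def o_def)
  have t_le: "t n \<le> 2" for n
    using norm_triangle_ineq4[of "f n" id_blinfun] norm_le_1_K[OF f(1)[of n]] norm_le_1_K[OF id_K]
    unfolding t_def by linarith
  have eventually_pos: "\<forall>\<^sub>F n in sequentially. 0 < r n"
    using eventually_gt_at_top[of 0] by eventually_elim (use rn in \<open>auto intro: less_le_trans\<close>)
  have lim_inverse: "(\<lambda>n. c / real (r n)) \<longlonglongrightarrow> 0" for c
    using LIMSEQ_subseq_LIMSEQ[OF lim_const_over_n[of c] r] by (simp add: o_def)
  have fixes_limit: "blinfun_apply l0 y = y"
    if "u \<longlonglongrightarrow> l0" "\<And>n. real (r n) * norm (blinfun_apply (u n) y - y) \<le> c" for u l0 c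
  proof -
    have "(\<lambda>n. norm (blinfun_apply (u n) y - y)) \<longlonglongrightarrow> norm (l0 y - y)"
      by (intro tendsto_intros that(1))
    moreover have "(\<lambda>n. norm (blinfun_apply (u n) y - y)) \<longlonglongrightarrow> 0"
    proof (rule tendsto_sandwich[OF _ _ tendsto_const lim_inverse[of c]])
      show "\<forall>\<^sub>F n in sequentially. norm (blinfun_apply (u n) y - y) \<le> c / real (r n)"
        using eventually_pos by eventually_elim (use that(2) in \<open>simp add: field_simps\<close>)
    qed simp
    ultimately have "norm (l0 y - y) = 0" by (rule LIMSEQ_unique)
    then show ?thesis by simp
  qed
  have f0y: "f0 y = y"
    using fixes_limit[OF lim_f, of 2] t_y t_le by (meson order_trans)
  have lim_t: "(\<lambda>n. t (r n)) \<longlonglongrightarrow> 0"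
  proof (rule tendsto_sandwich[OF _ _ tendsto_const])
    show "\<forall>\<^sub>F n in sequentially. 0 \<le> t (r n)" using t_pos by (simp add: less_imp_le)
    show "\<forall>\<^sub>F n in sequentially. t (r n) \<le> norm (f (r n) - f0)"
      using shorter[OF r1(1) f0y] by simp
    show "(\<lambda>n. norm (f (r n) - f0)) \<longlonglongrightarrow> 0"
      using lim_f LIM_zero tendsto_norm_zero by blast
  qed
  have "\<forall>\<^sub>F n in sequentially. t (r n) < 1/2"
    using order_tendstoD(2)[OF lim_t, of "1/2"] by simp
  moreover have "\<forall>\<^sub>F n in sequentially. norm (X (r n) - X0) < 1/4"
    using tendstoD[OF lim_X, of "1/4"] by (simp add: dist_norm)
  ultimately have "\<forall>\<^sub>F n in sequentially. t (r n) < 1/2 \<and> norm (X (r n) - X0) < 1/4"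
    by (rule eventually_conj)
  \<comment> \<open>The bounds are chosen so that 1/4 + 1/2 < 1, which gives the contradiction in
    the last estimate.\<close>
  then obtain M where M: "t M < 1/2" "norm (X M - X0) < 1/4"
    using eventually_happens'[OF sequentially_bot] by blast
  define s where "s = t M"
  \<comment> \<open>As the step length \<open>t (r n)\<close> tends to 0, this many powers of
    \<open>f (r n)\<close> travel the fixed length \<open>s\<close>. They still displace
    \<open>y\<close> by at most \<open>s / r n\<close>, so their limits lie in the isotropy
    group.\<close>
  define k where "k n = nat \<lfloor>s / t (r n)\<rfloor>" for n
  define l where "l n = ((\<lambda>l. f (r n) o\<^sub>L l) ^^ k n) id_blinfun" for n
  have s: "s > 0" using t_pos by (simp add: s_def)
  have real_k: "real (k n) = of_int \<lfloor>s / t (r n)\<rfloor>" for n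
    using s t_pos[of "r n"] by (simp add: k_def)
  have k_le: "k n * t (r n) \<le> s" for n
    unfolding real_k pos_le_divide_eq[OF t_pos, symmetric] by (rule of_int_floor_le)
  have k_ge: "s - t (r n) \<le> k n * t (r n)" for n
    using real_of_int_floor_add_one_ge[of "s / t (r n)"] t_pos[of "r n"] unfolding real_k
    by (simp add: field_simps)
  have lim_k: "(\<lambda>n. k n * t (r n)) \<longlonglongrightarrow> s"
  proof (rule tendsto_sandwich[OF _ _ _ tendsto_const])
    show "(\<lambda>n. s - t (r n)) \<longlonglongrightarrow> s"
      using tendsto_diff[OF tendsto_const lim_t, of s] by simp
  qed (use k_le k_ge in auto)
  have l_K: "l n \<in> K" for n
    unfolding l_def by (rule power_in_K[OF f(1)])
  have l_y: "real (r n) * norm (l n y - y) \<le> s" for n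
  proof -
    have "real (r n) * norm (l n y - y) \<le> real (r n) * (real (k n) * norm (f (r n) y - y))"
      unfolding l_def by (intro mult_left_mono norm_power_apply_minus f(1)) simp
    also have "\<dots> = real (k n) * (real (r n) * norm (f (r n) y - y))" by simp
    also have "\<dots> \<le> k n * t (r n)" by (intro mult_left_mono t_y) simp
    also have "\<dots> \<le> s" by (rule k_le)
    finally show ?thesis .
  qed
  have l_X: "norm (l n - id_blinfun - (k n * t (r n)) *\<^sub>R X (r n)) \<le> (k n * t (r n))\<^sup>2" for n
    using norm_power_minus_linear[OF f(1), of "k n" "r n"] t_pos[of "r n"]
    by (simp add: l_def X_def t_def)
  obtain l0 q where q: "l0 \<in> K" "strict_mono q" "(l \<circ> q) \<longlonglongrightarrow> l0"
    using compact_K l_K unfolding compact_def by blast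
  have l0_X: "norm (l0 - id_blinfun - s *\<^sub>R X0) \<le> s\<^sup>2"
  proof (rule tendsto_le[OF sequentially_bot])
    show "(\<lambda>n. norm ((l \<circ> q) n - id_blinfun - (k (q n) * t (r (q n))) *\<^sub>R X (r (q n))))
        \<longlonglongrightarrow> norm (l0 - id_blinfun - s *\<^sub>R X0)"
      using LIMSEQ_subseq_LIMSEQ[OF lim_X q(2)] LIMSEQ_subseq_LIMSEQ[OF lim_k q(2)]
      by (intro tendsto_intros q(3)) (simp_all add: o_def)
    show "(\<lambda>n. (k (q n) * t (r (q n)))\<^sup>2) \<longlonglongrightarrow> s\<^sup>2"
      using LIMSEQ_subseq_LIMSEQ[OF lim_k q(2)] by (intro tendsto_intros) (simp add: o_def)
  qed (use l_X in simp)
  have "real (r n) * norm ((l \<circ> q) n y - y) \<le> s" for n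
  proof -
    have "r n \<le> r (q n)" using r q(2) by (simp add: seq_suble strict_mono_less_eq)
    then have "real (r n) * norm (l (q n) y - y) \<le> real (r (q n)) * norm (l (q n) y - y)"
      by (intro mult_right_mono) auto
    then show ?thesis using l_y[of "q n"] by simp
  qed
  then have "blinfun_apply l0 y = y" by (rule fixes_limit[OF q(3)])
  then have "s \<le> norm (f M - l0)" using shorter[OF q(1)] by (simp add: s_def)
  also have "f M - l0 = s *\<^sub>R (X M - X0) - (l0 - id_blinfun - s *\<^sub>R X0)"
    by (simp add: f_X s_def algebra_simps)
  also have "norm \<dots> \<le> s * norm (X M - X0) + s\<^sup>2"
    using norm_triangle_ineq4[of "s *\<^sub>R (X M - X0)" "l0 - id_blinfun - s *\<^sub>R X0"] l0_X s by simp
  also have "\<dots> = s * (norm (X M - X0) + s)" by (simp add: power2_eq_square algebra_simps)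
  also have "\<dots> < s * 1" using M s by (intro mult_strict_left_mono) (auto simp: s_def)
  finally show False by simp
qed

section \<open>Normal spaces and slices\<close>

text \<open>
  The normal space of the orbit of \<open>y\<close> at \<open>y\<close>, expressed through the displacements \<open>k y - y\<close> so that
  no tangent vectors are needed.
\<close>

definition orbit_normal :: "'v \<Rightarrow> 'v set" where
  "orbit_normal y = {w. \<exists>C. \<forall>k\<in>K. \<bar>(k y - y) \<bullet> w\<bar> \<le> C * (norm (k y - y))\<^sup>2}"

lemma orbit_normal_self: "y \<in> orbit_normal y"
proof -
  have "\<bar>(k y - y) \<bullet> y\<bar> \<le> 1 * (norm (k y - y))\<^sup>2" if "k \<in> K" for k
    using displacement_inner[OF that, of y] by simp
  then show ?thesis unfolding orbit_normal_def by blast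
qed

lemma subspace_orbit_normal: "subspace (orbit_normal y)"
proof (rule subspaceI)
  show "0 \<in> orbit_normal y" by (auto simp: orbit_normal_def intro: exI[of _ 0])
next
  fix v w assume "v \<in> orbit_normal y" "w \<in> orbit_normal y"
  then obtain C D where "\<forall>k\<in>K. \<bar>(k y - y) \<bullet> v\<bar> \<le> C * (norm (k y - y))\<^sup>2"
    "\<forall>k\<in>K. \<bar>(k y - y) \<bullet> w\<bar> \<le> D * (norm (k y - y))\<^sup>2"
    by (auto simp: orbit_normal_def)
  then have "\<bar>(k y - y) \<bullet> (v + w)\<bar> \<le> (C + D) * (norm (k y - y))\<^sup>2" if "k \<in> K" for k
    using that abs_triangle_ineq[of "(k y - y) \<bullet> v" "(k y - y) \<bullet> w"]
    by (fastforce simp: inner_add_right distrib_right)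
  then show "v + w \<in> orbit_normal y" unfolding orbit_normal_def by blast
next
  fix c w assume "w \<in> orbit_normal y"
  then obtain C where C: "\<forall>k\<in>K. \<bar>(k y - y) \<bullet> w\<bar> \<le> C * (norm (k y - y))\<^sup>2"
    by (auto simp: orbit_normal_def)
  have "\<bar>(k y - y) \<bullet> (c *\<^sub>R w)\<bar> \<le> \<bar>c\<bar> * C * (norm (k y - y))\<^sup>2" if "k \<in> K" for k
    using mult_left_mono[OF bspec[OF C that], of "\<bar>c\<bar>"] by (simp add: abs_mult mult.assoc)
  then show "c *\<^sub>R w \<in> orbit_normal y" unfolding orbit_normal_def by blast
qed

lemma orbit_normal_apply:
  assumes "w \<in> orbit_normal y" "k \<in> stab y"
  shows "k w \<in> orbit_normal y"
proof -
  obtain C where C: "\<forall>k\<in>K. \<bar>(k y - y) \<bullet> w\<bar> \<le> C * (norm (k y - y))\<^sup>2"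
    using assms(1) by (auto simp: orbit_normal_def)
  have k: "k \<in> K" "k y = y" using assms(2) by (auto simp: stab_def)
  obtain l where l: "l \<in> K" "\<forall>x. blinfun_apply l (k x) = x" "\<forall>x y. x \<bullet> k y = blinfun_apply l x \<bullet> y"
    using inverse_apply_K[OF k(1)] by blast
  have ly: "l y = y" using l(2) k(2) by metis
  have "\<bar>(g y - y) \<bullet> k w\<bar> \<le> C * (norm (g y - y))\<^sup>2" if g: "g \<in> K" for g
  proof -
    have "l (g y - y) = (l o\<^sub>L g) y - y" by (simp add: blinfun.diff_right ly)
    then show ?thesis
      using bspec[OF C compose_K[OF l(1) g]] l(3) norm_apply_K[OF l(1), of "g y - y"] by simp
  qed
  then show ?thesis unfolding orbit_normal_def by blast
qed

text \<open>
  Maximality bounds \<open>(h y - y) \<bullet> w\<close> from above for \<open>h\<close> and for its inverse; up to second order in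
  \<open>h\<close> the two expressions are negatives of each other.
\<close>

lemma maximal_pair_orbit_normal:
  assumes max: "maximal_pair w y"
  shows "w \<in> orbit_normal y"
proof -
  obtain C where C: "C \<ge> 0" "\<forall>g\<in>K. \<exists>h\<in>K. blinfun_apply h y = blinfun_apply g y \<and>
      norm (h - id_blinfun) \<le> C * norm (blinfun_apply g y - y)"
    using orbit_lipschitz_representative by blast
  have "\<bar>(k y - y) \<bullet> w\<bar> \<le> C * norm w * (norm (k y - y))\<^sup>2" if k: "k \<in> K" for k
  proof -
    obtain h where h: "h \<in> K" "h y = k y" "norm (h - id_blinfun) \<le> C * norm (k y - y)"
      using C(2) k by blast
    obtain l where l: "l \<in> K" "\<forall>x y. x \<bullet> h y = blinfun_apply l x \<bullet> y"
      using inverse_apply_K[OF h(1)] by blast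
    have upper: "(k y - y) \<bullet> w \<le> 0"
      using max k by (simp add: maximal_pair_def inner_diff inner_commute)
    have "w \<bullet> l y \<le> w \<bullet> y" using max l(1) by (simp add: maximal_pair_def)
    then have "y \<bullet> (h w) \<le> y \<bullet> w" using l(2) by (simp add: inner_commute)
    moreover have "h y \<bullet> h w = y \<bullet> w" by (rule inner_K[OF h(1)])
    ultimately have "(h y - y) \<bullet> (h w) \<ge> 0" by (simp add: inner_diff_left)
    then have "- ((k y - y) \<bullet> w) \<le> (k y - y) \<bullet> (h w - w)"
      using h(2) by (simp add: inner_diff_right)
    also have "\<dots> \<le> norm (k y - y) * norm ((h - id_blinfun) w)"
      using norm_cauchy_schwarz by (simp add: blinfun.diff_left)
    also have "\<dots> \<le> norm (k y - y) * (C * norm (k y - y) * norm w)"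
      by (intro mult_left_mono order_trans[OF norm_blinfun] mult_right_mono h(3)) auto
    finally show ?thesis using upper by (simp add: power2_eq_square algebra_simps)
  qed
  then show ?thesis unfolding orbit_normal_def by blast
qed

text \<open>Expanding in an orthonormal basis makes the constant proportional to
  \<open>norm w\<close>, so that it becomes small for small \<open>w\<close>.\<close>

lemma orbit_normal_uniform:
  "\<exists>C\<ge>0. \<forall>w\<in>orbit_normal y. \<forall>k\<in>K. \<bar>(k y - y) \<bullet> w\<bar> \<le> C * norm w * (norm (k y - y))\<^sup>2"
proof -
  obtain B where B: "B \<subseteq> orbit_normal y" "pairwise orthogonal B" "\<And>b. b \<in> B \<Longrightarrow> norm b = 1"
    "independent B" "span B = orbit_normal y"
    using orthonormal_basis_subspace[OF subspace_orbit_normal] by metis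
  have fin: "finite B" using B(4) by (rule independent_imp_finite)
  have "\<forall>b\<in>B. \<exists>C. \<forall>k\<in>K. \<bar>(k y - y) \<bullet> b\<bar> \<le> C * (norm (k y - y))\<^sup>2"
    using B(1) by (auto simp: orbit_normal_def)
  then obtain c where c: "\<And>b k. \<lbrakk>b \<in> B; k \<in> K\<rbrakk> \<Longrightarrow> \<bar>(k y - y) \<bullet> b\<bar> \<le> c b * (norm (k y - y))\<^sup>2"
    by metis
  define C where "C = (\<Sum>b\<in>B. \<bar>c b\<bar>)"
  have "\<bar>(k y - y) \<bullet> w\<bar> \<le> C * norm w * (norm (k y - y))\<^sup>2" if w: "w \<in> orbit_normal y" and k: "k \<in> K" for w k
  proof -
    have "(\<Sum>b\<in>B. (w \<bullet> b) *\<^sub>R b) = w"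
      using orthonormal_basis_expand[OF B(2,3) _ fin] w B(5) by blast
    moreover have "(k y - y) \<bullet> (\<Sum>b\<in>B. (w \<bullet> b) *\<^sub>R b) = (\<Sum>b\<in>B. (w \<bullet> b) * ((k y - y) \<bullet> b))"
      by (simp add: inner_sum_right)
    ultimately have "\<bar>(k y - y) \<bullet> w\<bar> = \<bar>\<Sum>b\<in>B. (w \<bullet> b) * ((k y - y) \<bullet> b)\<bar>" by simp
    also have "\<dots> \<le> (\<Sum>b\<in>B. \<bar>(w \<bullet> b) * ((k y - y) \<bullet> b)\<bar>)" by (rule sum_abs)
    also have "\<dots> \<le> (\<Sum>b\<in>B. norm w * (\<bar>c b\<bar> * (norm (k y - y))\<^sup>2))"
    proof (rule sum_mono)
      fix b assume b: "b \<in> B"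
      have "\<bar>w \<bullet> b\<bar> \<le> norm w" using Cauchy_Schwarz_ineq2[of w b] B(3)[OF b] by simp
      moreover have "\<bar>(k y - y) \<bullet> b\<bar> \<le> \<bar>c b\<bar> * (norm (k y - y))\<^sup>2"
        using c[OF b k] mult_right_mono[OF abs_ge_self[of "c b"], of "(norm (k y - y))\<^sup>2"] by simp
      ultimately show "\<bar>(w \<bullet> b) * ((k y - y) \<bullet> b)\<bar> \<le> norm w * (\<bar>c b\<bar> * (norm (k y - y))\<^sup>2)"
        unfolding abs_mult by (intro mult_mono) auto
    qed
    also have "\<dots> = C * norm w * (norm (k y - y))\<^sup>2"
      by (simp add: C_def sum_distrib_left sum_distrib_right algebra_simps)
    finally show ?thesis .
  qed
  moreover have "C \<ge> 0" by (simp add: C_def sum_nonneg)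
  ultimately show ?thesis by blast
qed

text \<open>A displacement of \<open>y\<close> loses half its square against \<open>y\<close> and
  gains at most \<open>C * norm w\<close> times its square against \<open>w\<close>. For
  \<open>C * norm w < 1/2\<close> the loss wins, which explains \<delta>; the summand 1 there avoids
  division by 0. This plays the part of the slice theorem.\<close>

lemma normal_slice:
  "\<exists>\<delta>>0. \<forall>w\<in>orbit_normal y. norm w < \<delta> \<longrightarrow>
    (\<forall>k\<in>K. blinfun_apply k y \<noteq> y \<longrightarrow> (y + w) \<bullet> blinfun_apply k y < (y + w) \<bullet> y)"
proof -
  obtain C where C: "C \<ge> 0"
    "\<forall>w\<in>orbit_normal y. \<forall>k\<in>K. \<bar>(blinfun_apply k y - y) \<bullet> w\<bar> \<le> C * norm w * (norm (blinfun_apply k y - y))\<^sup>2"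
    using orbit_normal_uniform by blast
  define \<delta> where "\<delta> = 1 / (2 * (C + 1))"
  have "(y + w) \<bullet> k y < (y + w) \<bullet> y"
    if w: "w \<in> orbit_normal y" "norm w < \<delta>" and k: "k \<in> K" "k y \<noteq> y" for w k
  proof -
    have pos: "(norm (k y - y))\<^sup>2 > 0" using k(2) by simp
    have "C * norm w \<le> (C + 1) * norm w" by (simp add: algebra_simps)
    also have "\<dots> < (C + 1) * \<delta>" using w(2) C(1) by (intro mult_strict_left_mono) auto
    also have "\<dots> = 1/2" using C(1) by (simp add: \<delta>_def)
    finally have "C * norm w * (norm (k y - y))\<^sup>2 < 1/2 * (norm (k y - y))\<^sup>2"
      by (intro mult_strict_right_mono pos)
    then have "(k y - y) \<bullet> y + (k y - y) \<bullet> w < 0"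
      using C(2) w(1) k(1) displacement_inner[OF k(1), of y] by fastforce
    then show ?thesis by (simp add: inner_diff inner_add inner_commute)
  qed
  moreover have "\<delta> > 0" using C(1) by (simp add: \<delta>_def)
  ultimately show ?thesis by blast
qed

text \<open>An isometry fixing \<open>y + w\<close> preserves the value of this functional at
  \<open>y\<close>, and on the orbit of \<open>y\<close> only \<open>y\<close> attains that
  value.\<close>

lemma stab_normal_slice:
  "\<exists>\<delta>>0. \<forall>w\<in>orbit_normal y. norm w < \<delta> \<longrightarrow> stab (y + w) \<subseteq> stab y"
proof -
  obtain \<delta> where \<delta>: "\<delta> > 0" "\<forall>w\<in>orbit_normal y. norm w < \<delta> \<longrightarrow>
    (\<forall>k\<in>K. blinfun_apply k y \<noteq> y \<longrightarrow> (y + w) \<bullet> blinfun_apply k y < (y + w) \<bullet> y)"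
    using normal_slice by blast
  have "k \<in> stab y" if w: "w \<in> orbit_normal y" "norm w < \<delta>" and k: "k \<in> stab (y + w)" for w k
  proof (rule ccontr)
    have kK: "k \<in> K" and fix_yw: "k (y + w) = y + w" using k by (auto simp: stab_def)
    assume "k \<notin> stab y"
    then have "(y + w) \<bullet> k y < (y + w) \<bullet> y" using \<delta>(2) w kK by (auto simp: stab_def)
    moreover have "(y + w) \<bullet> k y = (y + w) \<bullet> y" using inner_K[OF kK, of "y + w" y] fix_yw by simp
    ultimately show False by simp
  qed
  then show ?thesis using \<delta>(1) by blast
qed

text \<open>An orbit passing near \<open>p\<close> meets the normal slice at \<open>p\<close> in its
  point closest to \<open>p\<close>, where the isotropy group is contained in that of
  \<open>p\<close>.\<close>

lemma regular_open:
  assumes "regular p"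
  shows "\<exists>\<delta>>0. \<forall>x. norm (x - p) < \<delta> \<longrightarrow> regular x"
proof -
  obtain \<delta> where \<delta>: "\<delta> > 0" "\<forall>w\<in>orbit_normal p. norm w < \<delta> \<longrightarrow> stab (p + w) \<subseteq> stab p"
    using stab_normal_slice by blast
  have "regular x" if x: "norm (x - p) < \<delta>" for x
  proof -
    obtain g where g: "g \<in> K" "maximal_pair p (g x)" using maximal_pair_exists by blast
    then have "g x \<in> orbit_normal p"
      using maximal_pair_orbit_normal maximal_pair_commute by blast
    then have "g x - p \<in> orbit_normal p"
      by (intro subspace_diff subspace_orbit_normal orbit_normal_self)
    moreover obtain l where l: "l \<in> K" "\<forall>x. blinfun_apply l (g x) = x"
      using inverse_apply_K[OF g(1)] by blast
    moreover have "norm (g x - p) < \<delta>"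
      using maximal_pair_norm_le[OF g(2) l(1)] l(2) x by (simp add: norm_minus_commute)
    ultimately have "stab (p + (g x - p)) \<subseteq> stab p" using \<delta>(2) by blast
    then have "regular (g x)" using regular_mono[OF assms] by simp
    then have "regular (l (g x))" using l(1) by (rule regular_apply)
    then show ?thesis using l(2) by simp
  qed
  then show ?thesis using \<delta>(1) by blast
qed

text \<open>The metric form of the fact that a line normal to one orbit is normal to every orbit it
  meets. Displacements of both \<open>y\<close> and \<open>w\<close> contribute terms quadratic in
  \<open>norm (h - id_blinfun)\<close>, and for a short representative \<open>h\<close> this norm is
  controlled by the displacement of the new point.\<close>

lemma orbit_normal_line:
  assumes "w \<in> orbit_normal y"
  shows "w \<in> orbit_normal (y + t *\<^sub>R w)"
proof -
  define z where "z = y + t *\<^sub>R w"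
  obtain D where D: "D \<ge> 0" "\<forall>w\<in>orbit_normal y. \<forall>k\<in>K. \<bar>(blinfun_apply k y - y) \<bullet> w\<bar> \<le> D * norm w * (norm (blinfun_apply k y - y))\<^sup>2"
    using orbit_normal_uniform by blast
  obtain C where C: "C \<ge> 0" "\<forall>g\<in>K. \<exists>h\<in>K. blinfun_apply h z = blinfun_apply g z \<and>
      norm (h - id_blinfun) \<le> C * norm (blinfun_apply g z - z)"
    using orbit_lipschitz_representative by blast
  define A where "A = D * norm w * (norm y)\<^sup>2 + \<bar>t\<bar> * (norm w)\<^sup>2"
  have A: "A \<ge> 0" using D(1) by (simp add: A_def)
  have "\<bar>(k z - z) \<bullet> w\<bar> \<le> A * C\<^sup>2 * (norm (k z - z))\<^sup>2" if k: "k \<in> K" for k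
  proof -
    obtain h where h: "h \<in> K" "h z = k z" "norm (h - id_blinfun) \<le> C * norm (k z - z)"
      using C(2) k by blast
    define a where "a = norm (h - id_blinfun)"
    have disp: "(norm (h x - x))\<^sup>2 \<le> a\<^sup>2 * (norm x)\<^sup>2" for x
    proof -
      have "norm (h x - x) \<le> a * norm x"
        using norm_blinfun[of "h - id_blinfun" x] by (simp add: a_def blinfun.diff_left)
      then have "(norm (h x - x))\<^sup>2 \<le> (a * norm x)\<^sup>2" by (intro power_mono) auto
      then show ?thesis by (simp add: power_mult_distrib)
    qed
    have 1: "\<bar>(h y - y) \<bullet> w\<bar> \<le> D * norm w * (a\<^sup>2 * (norm y)\<^sup>2)"
    proof -
      have "\<bar>(h y - y) \<bullet> w\<bar> \<le> D * norm w * (norm (h y - y))\<^sup>2" using D(2) assms h(1) by blast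
      also have "\<dots> \<le> D * norm w * (a\<^sup>2 * (norm y)\<^sup>2)"
        by (intro mult_left_mono disp) (use D(1) in auto)
      finally show ?thesis .
    qed
    have 2: "\<bar>(h w - w) \<bullet> w\<bar> \<le> a\<^sup>2 * (norm w)\<^sup>2"
    proof -
      have "\<bar>(h w - w) \<bullet> w\<bar> = (norm (h w - w))\<^sup>2 / 2"
        using displacement_inner[OF h(1), of w] by simp
      also have "\<dots> \<le> (norm (h w - w))\<^sup>2" by simp
      also have "\<dots> \<le> a\<^sup>2 * (norm w)\<^sup>2" by (rule disp)
      finally show ?thesis .
    qed
    have "(k z - z) \<bullet> w = (h y - y) \<bullet> w + t * ((h w - w) \<bullet> w)"
      unfolding h(2)[symmetric]
      by (simp add: z_def blinfun.add_right blinfun.scaleR_right inner_diff_left inner_add_left algebra_simps)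
    then have "\<bar>(k z - z) \<bullet> w\<bar> \<le> \<bar>(h y - y) \<bullet> w\<bar> + \<bar>t\<bar> * \<bar>(h w - w) \<bullet> w\<bar>"
      using abs_triangle_ineq by (simp add: abs_mult[symmetric])
    also have "\<dots> \<le> D * norm w * (a\<^sup>2 * (norm y)\<^sup>2) + \<bar>t\<bar> * (a\<^sup>2 * (norm w)\<^sup>2)"
      by (intro add_mono 1 mult_left_mono 2) simp
    also have "\<dots> = A * a\<^sup>2" by (simp add: A_def algebra_simps)
    also have "\<dots> \<le> A * (C * norm (k z - z))\<^sup>2"
      by (intro mult_left_mono power_mono A) (use h(3) in \<open>auto simp: a_def\<close>)
    finally show ?thesis by (simp add: power_mult_distrib mult.assoc)
  qed
  then show ?thesis unfolding orbit_normal_def z_def by blast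
qed

text \<open>The endpoint \<open>p + w\<close> may be singular. A map fixing a nearby point of the
  line also fixes \<open>p + w\<close> by the slice property, hence the whole line and with it
  \<open>p\<close>.\<close>

lemma regular_near_on_normal_line:
  assumes "regular p" "w \<in> orbit_normal p" "\<epsilon> > 0"
  shows "\<exists>s. norm (s *\<^sub>R w) < \<epsilon> \<and> regular (p + w + s *\<^sub>R w)"
proof -
  have w: "w \<in> orbit_normal (p + w)" using orbit_normal_line[OF assms(2), of 1] by simp
  obtain \<delta> where \<delta>: "\<delta> > 0" "\<forall>v\<in>orbit_normal (p + w). norm v < \<delta> \<longrightarrow> stab (p + w + v) \<subseteq> stab (p + w)"
    using stab_normal_slice by blast
  define s where "s = min \<delta> \<epsilon> / (2 * (norm w + 1))"
  have s: "s > 0" using \<delta>(1) assms(3) by (simp add: s_def add_nonneg_pos)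
  have "norm (s *\<^sub>R w) = s * norm w" using s by simp
  also have "\<dots> < s * (2 * (norm w + 1))"
    using s norm_ge_zero[of w] by (intro mult_strict_left_mono) (simp_all add: add_strict_increasing2)
  also have "\<dots> = min \<delta> \<epsilon>" using norm_ge_zero[of w] by (simp add: s_def add_nonneg_eq_0_iff)
  finally have small: "norm (s *\<^sub>R w) < \<delta>" "norm (s *\<^sub>R w) < \<epsilon>" by auto
  have "stab (p + w + s *\<^sub>R w) \<subseteq> stab p"
  proof
    fix k assume k: "k \<in> stab (p + w + s *\<^sub>R w)"
    then have "k \<in> stab (p + w)"
      using \<delta>(2) small(1) subspace_scale[OF subspace_orbit_normal w] by blast
    then have pw: "k (p + w) = p + w" and kK: "k \<in> K" by (auto simp: stab_def)
    moreover have "k (p + w + s *\<^sub>R w) = p + w + s *\<^sub>R w" using k by (simp add: stab_def)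
    ultimately have "s *\<^sub>R k w = s *\<^sub>R w" by (simp add: blinfun.add_right blinfun.scaleR_right)
    then have "k w = w" using s by simp
    then show "k \<in> stab p" using pw kK by (simp add: stab_def blinfun.add_right)
  qed
  then show ?thesis using small(2) regular_mono[OF assms(1)] by blast
qed

end

section \<open>Fat sections\<close>

lemma linear_blinfun_apply: "linear (blinfun_apply k)"
  by (rule blinfun.bounded_linear_right[THEN bounded_linear.linear])

text \<open>The inclusion of normal spaces in \<Sigma> is stated through maximal pairs, the form in
  which it follows from tangent vectors of curves.\<close>

locale fat_subspace = compact_orthogonal_group K
  for K :: "('v::euclidean_space \<Rightarrow>\<^sub>L 'v) set" +
  fixes \<Sigma> :: "'v set"
  assumes subspace_\<Sigma>: "subspace \<Sigma>"
    and meets_orbits: "\<exists>g\<in>K. blinfun_apply g x \<in> \<Sigma>"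
    and normal_in_\<Sigma>: "\<lbrakk>p \<in> \<Sigma>; regular p; maximal_pair w p\<rbrakk> \<Longrightarrow> w \<in> \<Sigma>"
    and regular_normalizes: "\<lbrakk>p \<in> \<Sigma>; regular p; g \<in> K; blinfun_apply g p \<in> \<Sigma>\<rbrakk> \<Longrightarrow> blinfun_apply g ` \<Sigma> = \<Sigma>"
begin

lemma closed_\<Sigma>: "closed \<Sigma>"
  by (rule closed_subspace[OF subspace_\<Sigma>])

text \<open>
  Let \<open>p\<close> be the point closest to \<open>q\<close> among the points of \<open>\<Sigma>\<close> on some regular orbit. For a regular
  \<open>x\<close> on the segment from \<open>p\<close> to \<open>q\<close>, the point of the orbit of \<open>p\<close> closest to \<open>x\<close> lies in \<open>\<Sigma>\<close> by
  the normal condition at \<open>x\<close>, so it is \<open>p\<close> itself. Hence the line through \<open>p\<close> and \<open>q\<close> is normal to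
  the orbit of \<open>p\<close>, and its points near \<open>q\<close> other than \<open>q\<close> are regular.
\<close>

lemma regular_dense:
  assumes q: "q \<in> \<Sigma>" and \<epsilon>: "\<epsilon> > 0"
  shows "\<exists>z\<in>\<Sigma>. regular z \<and> norm (z - q) < \<epsilon>"
proof -
  obtain p0 where p0: "regular p0" "p0 \<in> \<Sigma>"
  proof -
    obtain p1 where p1: "regular p1" using regular_exists by blast
    obtain g where g: "g \<in> K" "g p1 \<in> \<Sigma>" using meets_orbits by blast
    show thesis using that[OF regular_apply[OF p1 g(1)] g(2)] .
  qed
  define S where "S = (\<lambda>k. blinfun_apply k p0) ` K \<inter> \<Sigma>"
  have "compact S" unfolding S_def using compact_orbit_K closed_\<Sigma> by (rule compact_Int_closed)
  moreover have "p0 \<in> S" using p0(2) id_K by (auto simp: S_def intro!: image_eqI[of _ _ id_blinfun])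
  moreover have "continuous_on S (\<lambda>x. q \<bullet> x)" by (intro continuous_intros)
  ultimately have "\<exists>p\<in>S. \<forall>x\<in>S. q \<bullet> x \<le> q \<bullet> p" by (intro continuous_attains_sup) auto
  then obtain p where p: "p \<in> S" "\<And>x. x \<in> S \<Longrightarrow> q \<bullet> x \<le> q \<bullet> p" by blast
  have p_\<Sigma>: "p \<in> \<Sigma>" and reg: "regular p"
    using p(1) p0(1) by (auto simp: S_def intro: regular_apply)
  have orbit_S: "g p \<in> S" if "g \<in> K" "g p \<in> \<Sigma>" for g
  proof -
    obtain k where "k \<in> K" "p = k p0" using p(1) by (auto simp: S_def)
    then have "g p = (g o\<^sub>L k) p0" "g o\<^sub>L k \<in> K" using compose_K that(1) by auto
    then show ?thesis using that(2) unfolding S_def by blast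
  qed
  obtain \<delta> where \<delta>: "\<delta> > 0" "\<And>x. norm (x - p) < \<delta> \<Longrightarrow> regular x" using regular_open[OF reg] by blast
  define s where "s = min (1/2) (\<delta> / (2 * (norm (q - p) + 1)))"
  have s: "0 < s" "s < 1" using \<delta>(1) by (auto simp: s_def add_nonneg_pos min_less_iff_disj)
  define x where "x = p + s *\<^sub>R (q - p)"
  have "s * norm (q - p) < \<delta>"
  proof -
    have pos: "norm (q - p) + 1 > 0" by (simp add: add_nonneg_pos)
    have "s * norm (q - p) \<le> s * (norm (q - p) + 1)" using s by simp
    also have "\<dots> \<le> \<delta> / (2 * (norm (q - p) + 1)) * (norm (q - p) + 1)"
      using pos by (intro mult_right_mono) (auto simp: s_def)
    also have "\<dots> = \<delta> / 2" using pos by (simp add: field_simps)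
    also have "\<dots> < \<delta>" using \<delta>(1) by simp
    finally show ?thesis .
  qed
  then have x_reg: "regular x" using s by (intro \<delta>(2)) (simp add: x_def)
  have x_\<Sigma>: "x \<in> \<Sigma>"
    unfolding x_def by (intro subspace_add subspace_scale subspace_diff subspace_\<Sigma> p_\<Sigma> q)
  obtain g where g: "g \<in> K" "maximal_pair x (g p)" using maximal_pair_exists by blast
  then have "g p \<in> \<Sigma>" using normal_in_\<Sigma>[OF x_\<Sigma> x_reg] maximal_pair_commute by blast
  then have qgp: "q \<bullet> g p \<le> q \<bullet> p" using p(2) orbit_S[OF g(1)] by blast
  have xgp: "x \<bullet> p \<le> x \<bullet> g p"
  proof -
    obtain l where l: "l \<in> K" "\<forall>x. blinfun_apply l (g x) = x" using inverse_apply_K[OF g(1)] by blast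
    then show ?thesis using g(2) unfolding maximal_pair_def by (metis)
  qed
  \<comment> \<open>The functional \<open>x\<close> is a convex combination of \<open>p\<close> and
    \<open>q\<close>. Against \<open>p\<close>, the point \<open>g p\<close> is no better for
    \<open>q\<close> but at least as good for \<open>x\<close>, hence at least as good for the
    functional \<open>p\<close>, which only \<open>p\<close> itself maximizes on its orbit.\<close>
  have expand: "x \<bullet> u = (1 - s) * (p \<bullet> u) + s * (q \<bullet> u)" for u
    by (simp add: x_def inner_add_left inner_diff_left algebra_simps)
  have "s * (q \<bullet> g p) \<le> s * (q \<bullet> p)" using qgp s by (intro mult_left_mono) auto
  then have "(1 - s) * (p \<bullet> p) \<le> (1 - s) * (p \<bullet> g p)" using xgp unfolding expand by linarith
  then have "p \<bullet> p \<le> p \<bullet> g p" using s by (simp add: mult_le_cancel_left_pos)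
  moreover have "(g p - p) \<bullet> p = p \<bullet> g p - p \<bullet> p" by (simp add: inner_diff inner_commute)
  ultimately have "(norm (g p - p))\<^sup>2 \<le> 0" using displacement_inner[OF g(1), of p] by linarith
  then have "g p = p" by simp
  then have "x \<in> orbit_normal p" using maximal_pair_orbit_normal g(2) by simp
  then have "(1 / s) *\<^sub>R (x - p) \<in> orbit_normal p"
    by (intro subspace_scale subspace_diff subspace_orbit_normal orbit_normal_self)
  then have w: "q - p \<in> orbit_normal p" using s by (simp add: x_def)
  obtain t where t: "norm (t *\<^sub>R (q - p)) < \<epsilon>" "regular (p + (q - p) + t *\<^sub>R (q - p))"
    using regular_near_on_normal_line[OF reg w \<epsilon>] by blast
  have "q + t *\<^sub>R (q - p) \<in> \<Sigma>"
    by (intro subspace_add subspace_scale subspace_diff subspace_\<Sigma> p_\<Sigma> q)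
  then show ?thesis using t by (intro bexI[of _ "q + t *\<^sub>R (q - p)"]) simp_all
qed

lemma regular_sequence:
  assumes "q \<in> \<Sigma>"
  obtains z where "\<And>n. z n \<in> \<Sigma>" "\<And>n. regular (z n)" "z \<longlonglongrightarrow> q"
proof -
  have "\<forall>n. \<exists>z. z \<in> \<Sigma> \<and> regular z \<and> norm (z - q) < inverse (real (Suc n))"
    using regular_dense[OF assms] by (metis inverse_positive_iff_positive of_nat_0_less_iff zero_less_Suc)
  then obtain z where z: "\<And>n. z n \<in> \<Sigma>" "\<And>n. regular (z n)"
    "\<And>n. norm (z n - q) < inverse (real (Suc n))" by metis
  have "(\<lambda>n. z n - q) \<longlonglongrightarrow> 0"
    by (rule Lim_null_comparison[OF _ LIMSEQ_inverse_real_of_nat])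
      (use z(3) in \<open>auto intro: less_imp_le always_eventually\<close>)
  then show thesis using that z LIM_zero_cancel by blast
qed

text \<open>For a regular functional all maximizers lie in \<Sigma>, by symmetry of maximal pairs.
  For a singular one this survives only for limits of such maximizers along regular functionals
  tending to \<open>p\<close>.\<close>

lemma maximizer_in_\<Sigma>:
  assumes p: "p \<in> \<Sigma>"
  shows "\<exists>k\<in>K. blinfun_apply k y \<in> \<Sigma> \<and> maximal_pair p (blinfun_apply k y)"
proof -
  obtain z where z: "\<And>n. z n \<in> \<Sigma>" "\<And>n. regular (z n)" "z \<longlonglongrightarrow> p"
    using regular_sequence[OF p] by blast
  have "\<forall>n. \<exists>k\<in>K. maximal_pair (z n) (blinfun_apply k y)" using maximal_pair_exists by blast
  then obtain f where f: "\<And>n. f n \<in> K" "\<And>n. maximal_pair (z n) (blinfun_apply (f n) y)" by metis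
  have f_\<Sigma>: "f n y \<in> \<Sigma>" for n
    using normal_in_\<Sigma>[OF z(1,2)] f(2) maximal_pair_commute by blast
  obtain k r where k: "k \<in> K" "strict_mono r" "(f \<circ> r) \<longlonglongrightarrow> k"
    using compact_K f(1) unfolding compact_def by blast
  have lim: "(\<lambda>n. f (r n) y) \<longlonglongrightarrow> k y"
    using k(3) by (intro tendsto_intros) (simp add: o_def)
  have limz: "(\<lambda>n. z (r n)) \<longlonglongrightarrow> p" using LIMSEQ_subseq_LIMSEQ[OF z(3) k(2)] by (simp add: o_def)
  have "k y \<in> \<Sigma>" using closed_sequentially[OF closed_\<Sigma> _ lim] f_\<Sigma> by blast
  moreover have "p \<bullet> h (k y) \<le> p \<bullet> k y" if h: "h \<in> K" for h
  proof (rule tendsto_le[OF sequentially_bot])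
    show "(\<lambda>n. z (r n) \<bullet> f (r n) y) \<longlonglongrightarrow> p \<bullet> k y" by (intro tendsto_intros lim limz)
    show "(\<lambda>n. z (r n) \<bullet> h (f (r n) y)) \<longlonglongrightarrow> p \<bullet> h (k y)" by (intro tendsto_intros lim limz)
  qed (use f(2) h in \<open>auto simp: maximal_pair_def\<close>)
  ultimately show ?thesis using k(1) by (auto simp: maximal_pair_def)
qed

lemma normalizes_if_subset:
  assumes "k \<in> K" "blinfun_apply k ` \<Sigma> \<subseteq> \<Sigma>"
  shows "blinfun_apply k ` \<Sigma> = \<Sigma>"
proof (rule subspace_dim_equal[OF _ subspace_\<Sigma> assms(2)])
  show "subspace (blinfun_apply k ` \<Sigma>)" using linear_blinfun_apply subspace_\<Sigma> by (rule linear_subspace_image)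
  have "inj (blinfun_apply k)" using orthogonal_K[OF assms(1)] by (rule orthogonal_transformation_inj)
  then show "dim \<Sigma> \<le> dim (blinfun_apply k ` \<Sigma>)"
    using dim_image_eq[OF linear_blinfun_apply, of k \<Sigma>] by (simp add: inj_on_subset)
qed

text \<open>For regular points this is condition (C). In general \<open>x\<close> and
  \<open>g x\<close> are approximated separately, since \<open>g\<close> need not keep the points
  near \<open>x\<close> inside \<Sigma>. The point closest to \<open>z n\<close> on the orbit of
  \<open>u n\<close> lies in \<Sigma> and is at least as close as \<open>g (u n)\<close>, so the
  maps \<open>f n\<close> accumulate at a normalizing map with the same value at
  \<open>x\<close>.\<close>

lemma orbit_meets_\<Sigma>_in_normalizer_orbit:
  assumes x: "x \<in> \<Sigma>" and g: "g \<in> K" "blinfun_apply g x \<in> \<Sigma>"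
  shows "\<exists>h\<in>K. blinfun_apply h ` \<Sigma> = \<Sigma> \<and> blinfun_apply h x = blinfun_apply g x"
proof -
  obtain u where u: "\<And>n. u n \<in> \<Sigma>" "\<And>n. regular (u n)" "u \<longlonglongrightarrow> x"
    using regular_sequence[OF x] by blast
  obtain z where z: "\<And>n. z n \<in> \<Sigma>" "\<And>n. regular (z n)" "z \<longlonglongrightarrow> g x"
    using regular_sequence[OF g(2)] by blast
  have "\<forall>n. \<exists>k\<in>K. maximal_pair (z n) (blinfun_apply k (u n))" using maximal_pair_exists by blast
  then obtain f where f: "\<And>n. f n \<in> K" "\<And>n. maximal_pair (z n) (blinfun_apply (f n) (u n))" by metis
  have f_\<Sigma>: "f n (u n) \<in> \<Sigma>" for n
    using normal_in_\<Sigma>[OF z(1,2)] f(2) maximal_pair_commute by blast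
  have f_N: "f n ` \<Sigma> = \<Sigma>" for n by (rule regular_normalizes[OF u(1,2) f(1) f_\<Sigma>])
  have close: "norm (z n - f n (u n)) \<le> norm (z n - g (u n))" for n
  proof -
    obtain l where l: "l \<in> K" "\<forall>x. blinfun_apply l (f n x) = x" using inverse_apply_K[OF f(1)] by blast
    show ?thesis
      using maximal_pair_norm_le[OF f(2) compose_K[OF g(1) l(1)], of n] l(2) by simp
  qed
  obtain k r where k: "k \<in> K" "strict_mono r" "(f \<circ> r) \<longlonglongrightarrow> k"
    using compact_K f(1) unfolding compact_def by blast
  have limf: "(\<lambda>n. f (r n)) \<longlonglongrightarrow> k" using k(3) by (simp add: o_def)
  have limz: "(\<lambda>n. z (r n)) \<longlonglongrightarrow> g x" using LIMSEQ_subseq_LIMSEQ[OF z(3) k(2)] by (simp add: o_def)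
  have limu: "(\<lambda>n. u (r n)) \<longlonglongrightarrow> x" using LIMSEQ_subseq_LIMSEQ[OF u(3) k(2)] by (simp add: o_def)
  have "norm (g x - k x) \<le> norm (g x - g x)"
  proof (rule tendsto_le[OF sequentially_bot])
    show "(\<lambda>n. norm (z (r n) - g (u (r n)))) \<longlonglongrightarrow> norm (g x - g x)"
      by (intro tendsto_intros limz limu)
    show "(\<lambda>n. norm (z (r n) - f (r n) (u (r n)))) \<longlonglongrightarrow> norm (g x - k x)"
      by (intro tendsto_intros limz limu limf)
  qed (use close in simp)
  then have "k x = g x" by simp
  moreover have "k y \<in> \<Sigma>" if y: "y \<in> \<Sigma>" for y
  proof (rule closed_sequentially[OF closed_\<Sigma>])
    show "(\<lambda>n. f (r n) y) \<longlonglongrightarrow> k y" by (intro tendsto_intros limf)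
    show "f (r n) y \<in> \<Sigma>" for n using f_N[of "r n"] y by blast
  qed
  then have "k ` \<Sigma> = \<Sigma>" by (intro normalizes_if_subset k(1)) blast
  ultimately show ?thesis using k(1) by blast
qed

end

section \<open>Orthogonal projection and isotropy representations\<close>

lemma orthogonal_projection_unique:
  fixes \<Sigma> :: "'v::euclidean_space set"
  assumes "subspace \<Sigma>"
  shows "\<exists>!y. y \<in> \<Sigma> \<and> x - y \<in> orthogonal_comp \<Sigma>"
proof (rule ex_ex1I)
  have "x \<in> \<Sigma> + orthogonal_comp \<Sigma>" using subspace_sum_orthogonal_comp[OF assms] by simp
  then obtain y z where "y \<in> \<Sigma>" "z \<in> orthogonal_comp \<Sigma>" "x = y + z" by (rule set_plus_elim)
  then show "\<exists>y. y \<in> \<Sigma> \<and> x - y \<in> orthogonal_comp \<Sigma>" by (intro exI[of _ y]) simp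
next
  fix y z
  assume y: "y \<in> \<Sigma> \<and> x - y \<in> orthogonal_comp \<Sigma>" and z: "z \<in> \<Sigma> \<and> x - z \<in> orthogonal_comp \<Sigma>"
  have "(x - y) - (x - z) \<in> orthogonal_comp \<Sigma>"
    using y z by (intro subspace_diff[OF subspace_orthogonal_comp, of "x - y" \<Sigma> "x - z"]) auto
  moreover have "z - y \<in> \<Sigma>" using y z assms by (intro subspace_diff) auto
  ultimately have "(z - y) \<bullet> (z - y) = 0" by (auto simp: orthogonal_comp_def orthogonal_def)
  then show "y = z" by simp
qed

lemma
  assumes "subspace \<Sigma>"
  shows orthogonal_projection_in: "orthogonal_projection \<Sigma> x \<in> \<Sigma>"
    and orthogonal_projection_diff: "x - orthogonal_projection \<Sigma> x \<in> orthogonal_comp \<Sigma>"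
  using theI'[OF orthogonal_projection_unique[OF assms]]
  by (auto simp: orthogonal_projection_def)

lemma orthogonal_projection_eqI:
  "\<lbrakk>subspace \<Sigma>; y \<in> \<Sigma>; x - y \<in> orthogonal_comp \<Sigma>\<rbrakk> \<Longrightarrow> orthogonal_projection \<Sigma> x = y"
  unfolding orthogonal_projection_def
  by (rule the1_equality[OF orthogonal_projection_unique]) auto

lemma orthogonal_projection_id:
  "\<lbrakk>subspace \<Sigma>; x \<in> \<Sigma>\<rbrakk> \<Longrightarrow> orthogonal_projection \<Sigma> x = x"
  by (rule orthogonal_projection_eqI) (auto simp: subspace_0 subspace_orthogonal_comp)

lemma inner_orthogonal_projection:
  assumes "subspace \<Sigma>" "p \<in> \<Sigma>"
  shows "p \<bullet> orthogonal_projection \<Sigma> x = p \<bullet> x"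
proof -
  have "p \<bullet> (x - orthogonal_projection \<Sigma> x) = 0"
    using orthogonal_projection_diff[OF assms(1), of x] assms(2)
    by (auto simp: orthogonal_comp_def orthogonal_def)
  then show ?thesis by (simp add: inner_diff_right)
qed

lemma linear_orthogonal_projection:
  assumes "subspace \<Sigma>"
  shows "linear (orthogonal_projection \<Sigma>)"
proof (rule linearI)
  let ?\<sigma> = "orthogonal_projection \<Sigma>"
  note \<sigma> = orthogonal_projection_in[OF assms] orthogonal_projection_diff[OF assms]
  fix x y
  have "(x - ?\<sigma> x) + (y - ?\<sigma> y) \<in> orthogonal_comp \<Sigma>"
    by (intro subspace_add subspace_orthogonal_comp \<sigma>)
  then show "?\<sigma> (x + y) = ?\<sigma> x + ?\<sigma> y"
    by (intro orthogonal_projection_eqI assms subspace_add \<sigma>) (simp add: algebra_simps)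
next
  let ?\<sigma> = "orthogonal_projection \<Sigma>"
  note \<sigma> = orthogonal_projection_in[OF assms] orthogonal_projection_diff[OF assms]
  fix c x
  have "c *\<^sub>R (x - ?\<sigma> x) \<in> orthogonal_comp \<Sigma>"
    by (intro subspace_scale subspace_orthogonal_comp \<sigma>)
  then show "?\<sigma> (c *\<^sub>R x) = c *\<^sub>R ?\<sigma> x"
    by (intro orthogonal_projection_eqI assms subspace_scale \<sigma>) (simp add: algebra_simps)
qed

text \<open>The hyperplane cuts a face out of the hull, and a face of a hull is the hull of some of
  the generators.\<close>

lemma convex_hull_Int_supporting_hyperplane:
  fixes S :: "'a::euclidean_space set"
  assumes "compact S" "\<And>x. x \<in> S \<Longrightarrow> a \<bullet> x \<le> b" "y \<in> convex hull S" "a \<bullet> y = b"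
  shows "y \<in> convex hull (S \<inter> {x. a \<bullet> x = b})"
proof -
  have "convex hull S \<subseteq> {x. a \<bullet> x \<le> b}"
    using assms(2) by (intro hull_minimal) (auto simp: convex_halfspace_le)
  then have "(convex hull S) \<inter> {x. a \<bullet> x = b} face_of (convex hull S)"
    by (intro face_of_Int_supporting_hyperplane_le) auto
  then obtain S' where S': "S' \<subseteq> S" "(convex hull S) \<inter> {x. a \<bullet> x = b} = convex hull S'"
    using face_of_convex_hull_subset[OF assms(1)] by metis
  then have "S' \<subseteq> S \<inter> {x. a \<bullet> x = b}" using hull_subset[of S' convex] by blast
  then show ?thesis using S'(2) assms(3,4) hull_mono by blast
qed

text \<open>
  The last two conditions are what remains of a fat section on passing to the isotropy group of a
  point \<open>v\<close> of \<open>\<Sigma>\<close> and to the normal space of its orbit.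
\<close>

locale orbit_reduction = compact_orthogonal_group K
  for K :: "('v::euclidean_space \<Rightarrow>\<^sub>L 'v) set" +
  fixes \<Sigma> W :: "'v set"
  assumes subspace_\<Sigma>: "subspace \<Sigma>"
    and subspace_W: "subspace W"
    and invariant_W: "\<lbrakk>k \<in> K; x \<in> W\<rbrakk> \<Longrightarrow> blinfun_apply k x \<in> W"
    and maximizer: "\<lbrakk>p \<in> \<Sigma> \<inter> W; y \<in> W\<rbrakk> \<Longrightarrow>
      \<exists>k\<in>K. blinfun_apply k y \<in> \<Sigma> \<and> maximal_pair p (blinfun_apply k y)"
    and projection_in_hull: "y \<in> W \<Longrightarrow>
      orthogonal_projection \<Sigma> y \<in> convex hull ((\<lambda>k. blinfun_apply k y) ` K)"

context fat_subspace
begin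

text \<open>The hull condition is a convexity statement in the style of Kostant. If a functional
  \<open>a\<close> separated the projection of \<open>y\<close> from the orbit, its own projection
  to \<Sigma> would agree with it on \<Sigma> and be minimized over the orbit at a point of
  \<Sigma>, with a value at most that at \<open>y\<close>. The minus sign turns maximizers into
  minimizers.\<close>

lemma orbit_reduction_UNIV: "orbit_reduction K \<Sigma> UNIV"
proof
  fix y :: 'v
  let ?H = "convex hull ((\<lambda>k. blinfun_apply k y) ` K)" and ?\<sigma> = "orthogonal_projection \<Sigma>"
  show "?\<sigma> y \<in> ?H"
  proof (rule ccontr)
    assume "?\<sigma> y \<notin> ?H"
    moreover have "convex ?H" "closed ?H"
      by (auto intro: compact_imp_closed compact_convex_hull compact_orbit_K)
    ultimately obtain a b where ab: "a \<bullet> ?\<sigma> y < b" "\<forall>x\<in>?H. b < a \<bullet> x"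
      using separating_hyperplane_closed_point by metis
    obtain k where k: "k \<in> K" "k y \<in> \<Sigma>" "maximal_pair (- ?\<sigma> a) (k y)"
      using maximizer_in_\<Sigma>[of "- ?\<sigma> a" y] orthogonal_projection_in[OF subspace_\<Sigma>]
        subspace_neg[OF subspace_\<Sigma>] by blast
    have flip: "a \<bullet> x = ?\<sigma> a \<bullet> x" if "x \<in> \<Sigma>" for x
      using inner_orthogonal_projection[OF subspace_\<Sigma> that, of a] by (simp add: inner_commute)
    obtain l where l: "l \<in> K" "\<forall>x. blinfun_apply l (k x) = x" using inverse_apply_K[OF k(1)] by blast
    have "k y \<in> ?H" using k(1) by (auto intro: hull_inc)
    then have "b < ?\<sigma> a \<bullet> k y" using ab(2) flip[OF k(2)] by auto
    also have "\<dots> \<le> ?\<sigma> a \<bullet> y" using k(3) l by (fastforce simp: maximal_pair_def)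
    also have "\<dots> = a \<bullet> ?\<sigma> y"
      using inner_orthogonal_projection[OF subspace_\<Sigma> orthogonal_projection_in[OF subspace_\<Sigma>], of a y]
        flip[OF orthogonal_projection_in[OF subspace_\<Sigma>], of y] by simp
    finally show False using ab(1) by simp
  qed
qed (use subspace_\<Sigma> maximizer_in_\<Sigma> in auto)

end

section \<open>Descent to isotropy groups\<close>

context compact_orthogonal_group
begin

lemma compact_orthogonal_group_stab: "compact_orthogonal_group (stab v)"
proof
  have "closed {k. blinfun_apply k v = v}" by (intro closed_Collect_eq continuous_intros)
  then have "compact (K \<inter> {k. blinfun_apply k v = v})" by (rule compact_Int_closed[OF compact_K])
  then show "compact (stab v)" by (simp add: stab_def Collect_conj_eq)
  show "id_blinfun \<in> stab v" using id_K by (simp add: stab_def)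
  show "k o\<^sub>L l \<in> stab v" if "k \<in> stab v" "l \<in> stab v" for k l
    using that by (simp add: stab_def compose_K)
  show "orthogonal_transformation (blinfun_apply k)" if "k \<in> stab v" for k
    using that by (simp add: stab_def orthogonal_K)
  show "\<exists>l\<in>stab v. l o\<^sub>L k = id_blinfun \<and> k o\<^sub>L l = id_blinfun" if k: "k \<in> stab v" for k
  proof -
    have kK: "k \<in> K" "k v = v" using k by (auto simp: stab_def)
    obtain l where l: "l \<in> K" "l o\<^sub>L k = id_blinfun" "k o\<^sub>L l = id_blinfun" "\<forall>x. blinfun_apply l (k x) = x"
      using inverse_apply_K[OF kK(1)] by blast
    have "l v = v" using l(4) kK(2) by metis
    then show ?thesis using l by (auto simp: stab_def)
  qed
qed

text \<open>
  For small \<open>\<delta>\<close> the functional \<open>v\<close> is maximal on the orbit of \<open>v + \<delta> y\<close> exactly at the points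
  \<open>k (v + \<delta> y)\<close> with \<open>k\<close> in the isotropy group of \<open>v\<close>, and it has the same value at the projection.
\<close>

lemma projection_in_stab_hull:
  assumes \<Sigma>: "subspace \<Sigma>" and v: "v \<in> \<Sigma>" and y: "y \<in> orbit_normal v"
    and hull: "\<And>\<delta>. orthogonal_projection \<Sigma> (v + \<delta> *\<^sub>R y) \<in>
      convex hull ((\<lambda>k. blinfun_apply k (v + \<delta> *\<^sub>R y)) ` K)"
  shows "orthogonal_projection \<Sigma> y \<in> convex hull ((\<lambda>k. blinfun_apply k y) ` stab v)"
proof -
  let ?\<sigma> = "orthogonal_projection \<Sigma>"
  obtain e where e: "e > 0" "\<forall>w\<in>orbit_normal v. norm w < e \<longrightarrow>
      (\<forall>k\<in>K. blinfun_apply k v \<noteq> v \<longrightarrow> (v + w) \<bullet> blinfun_apply k v < (v + w) \<bullet> v)"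
    using normal_slice by blast
  define \<delta> where "\<delta> = e / (2 * (norm y + 1))"
  have pos: "norm y + 1 > 0" by (simp add: add_nonneg_pos)
  have \<delta>: "\<delta> > 0" using e(1) pos by (simp add: \<delta>_def)
  have "norm (\<delta> *\<^sub>R y) \<le> \<delta> * (norm y + 1)" using \<delta> by simp
  also have "\<dots> = e / 2" using pos by (simp add: \<delta>_def field_simps)
  also have "\<dots> < e" using e(1) by simp
  finally have small: "norm (\<delta> *\<^sub>R y) < e" .
  define z where "z = v + \<delta> *\<^sub>R y"
  have less: "z \<bullet> k v < z \<bullet> v" if "k \<in> K" "k v \<noteq> v" for k
    unfolding z_def using e(2) small subspace_scale[OF subspace_orbit_normal y] that by blast
  have kz: "v \<bullet> k z < v \<bullet> z" if k: "k \<in> K" "k v \<noteq> v" for k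
  proof -
    obtain l where l: "l \<in> K" "\<forall>x y. x \<bullet> k y = blinfun_apply l x \<bullet> y" "\<forall>x. blinfun_apply k (l x) = x"
      using inverse_apply_K[OF k(1)] by blast
    have "l v \<noteq> v" using l(3) k(2) by metis
    then show ?thesis using less[OF l(1)] l(2) by (simp add: inner_commute)
  qed
  have \<sigma>z: "?\<sigma> z = v + \<delta> *\<^sub>R ?\<sigma> y"
    using linear_orthogonal_projection[OF \<Sigma>] orthogonal_projection_id[OF \<Sigma> v]
    by (simp add: z_def linear_add linear_scale)
  have in_hull: "?\<sigma> z \<in> convex hull ((\<lambda>k. blinfun_apply k z) ` K \<inter> {x. v \<bullet> x = v \<bullet> z})"
  proof (rule convex_hull_Int_supporting_hyperplane[OF compact_orbit_K])
    show "v \<bullet> x \<le> v \<bullet> z" if x: "x \<in> (\<lambda>k. blinfun_apply k z) ` K" for x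
    proof -
      obtain k where k: "k \<in> K" "x = k z" using x by blast
      show ?thesis
      proof (cases "k v = v")
        case True
        then have "v \<bullet> k z = v \<bullet> z" using inner_K[OF k(1), of v z] by simp
        then show ?thesis using k(2) by simp
      qed (use kz[OF k(1)] k(2) in auto)
    qed
    show "?\<sigma> z \<in> convex hull ((\<lambda>k. blinfun_apply k z) ` K)" using hull by (simp add: z_def)
    show "v \<bullet> ?\<sigma> z = v \<bullet> z" by (rule inner_orthogonal_projection[OF \<Sigma> v])
  qed
  have "(\<lambda>k. blinfun_apply k z) ` K \<inter> {x. v \<bullet> x = v \<bullet> z} \<subseteq> (\<lambda>k. blinfun_apply k z) ` stab v"
    using kz by (force simp: stab_def)
  also have "(\<lambda>k. blinfun_apply k z) ` stab v = (\<lambda>x. v + \<delta> *\<^sub>R x) ` (\<lambda>k. blinfun_apply k y) ` stab v"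
    unfolding image_image
    by (rule image_cong) (auto simp: z_def stab_def blinfun.add_right blinfun.scaleR_right)
  finally have "?\<sigma> z \<in> convex hull ((\<lambda>x. v + \<delta> *\<^sub>R x) ` (\<lambda>k. blinfun_apply k y) ` stab v)"
    using in_hull by (rule subsetD[OF hull_mono])
  then have "?\<sigma> z \<in> (\<lambda>x. v + \<delta> *\<^sub>R x) ` (convex hull ((\<lambda>k. blinfun_apply k y) ` stab v))"
    by (simp only: convex_hull_affinity)
  then show ?thesis using \<delta> by (auto simp: \<sigma>z)
qed

end

context orbit_reduction
begin

text \<open>
  Apply the maximizing property to \<open>v + \<delta> p\<close> and \<open>v + \<delta> y\<close> and let \<open>\<delta>\<close> tend to \<open>0\<close>. Comparing with
  the values at elements of the isotropy group of \<open>v\<close> shows that the maximizers \<open>k\<close> displace \<open>v\<close>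
  by \<open>o(\<delta>)\<close>.
\<close>

lemma stab_maximizer:
  assumes v: "v \<in> \<Sigma> \<inter> W" and p: "p \<in> \<Sigma> \<inter> (W \<inter> orbit_normal v)" and y: "y \<in> W \<inter> orbit_normal v"
  shows "\<exists>k\<in>stab v. blinfun_apply k y \<in> \<Sigma> \<and> (\<forall>h\<in>stab v. p \<bullet> blinfun_apply h y \<le> p \<bullet> blinfun_apply k y)"
proof -
  obtain C1 where C1: "C1 \<ge> 0" "\<forall>w\<in>orbit_normal v. \<forall>k\<in>K.
      \<bar>(blinfun_apply k v - v) \<bullet> w\<bar> \<le> C1 * norm w * (norm (blinfun_apply k v - v))\<^sup>2"
    using orbit_normal_uniform by blast
  define C where "C = C1 * (norm p + norm y)"
  have C: "C \<ge> 0" using C1(1) by (simp add: C_def)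
  have CC: "(k v - v) \<bullet> p \<le> C * (norm (k v - v))\<^sup>2" "(k v - v) \<bullet> y \<le> C * (norm (k v - v))\<^sup>2"
    if k: "k \<in> K" for k
  proof -
    have bound: "(k v - v) \<bullet> w \<le> C * (norm (k v - v))\<^sup>2" if "w \<in> orbit_normal v" "norm w \<le> norm p + norm y" for w
    proof -
      have "(k v - v) \<bullet> w \<le> C1 * norm w * (norm (k v - v))\<^sup>2"
        using C1(2) that(1) k abs_le_D1 by blast
      also have "\<dots> \<le> C * (norm (k v - v))\<^sup>2"
        unfolding C_def by (intro mult_right_mono mult_left_mono that(2) C1(1)) simp
      finally show ?thesis .
    qed
    show "(k v - v) \<bullet> p \<le> C * (norm (k v - v))\<^sup>2" "(k v - v) \<bullet> y \<le> C * (norm (k v - v))\<^sup>2"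
      using p y by (auto intro: bound)
  qed
  \<comment> \<open>The offset ensures \<open>2 * C * d n \<le> 1/4\<close>, so that in
    \<open>key\<close> the two error terms use up at most half of the loss
    \<open>?D / 2\<close>.\<close>
  define d where "d n = 1 / (real n + 8 * (C + 1))" for n
  have d_pos: "d n > 0" for n using C by (simp add: d_def add_nonneg_pos)
  have d_C: "2 * C * d n \<le> 1/4" for n
    using C by (simp add: d_def field_simps)
  have lim_d: "d \<longlonglongrightarrow> 0" unfolding d_def by real_asymp
  have "\<forall>n. \<exists>k\<in>K. blinfun_apply k (v + d n *\<^sub>R y) \<in> \<Sigma> \<and>
      maximal_pair (v + d n *\<^sub>R p) (blinfun_apply k (v + d n *\<^sub>R y))"
    using v p y by (intro allI maximizer) (auto intro: subspace_add subspace_scale subspace_\<Sigma> subspace_W)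
  then obtain f where f: "\<And>n. f n \<in> K" "\<And>n. f n (v + d n *\<^sub>R y) \<in> \<Sigma>"
    "\<And>n. maximal_pair (v + d n *\<^sub>R p) (f n (v + d n *\<^sub>R y))" by metis
  \<comment> \<open>Since \<open>h\<close> fixes \<open>v\<close> and both \<open>p\<close> and
    \<open>y\<close> are normal at \<open>v\<close>, the first-order terms in \<open>d n\<close> on
    the two sides differ by at most \<open>2 * C * d n * ?D\<close>. What remains of the loss in
    \<open>v \<bullet> f n v\<close> must be paid by the second-order term.\<close>
  have key: "(norm (f n v - v))\<^sup>2 \<le> 4 * (d n)\<^sup>2 * (p \<bullet> f n y - p \<bullet> h y)" if h: "h \<in> stab v" for n h
  proof -
    have hK: "h \<in> K" and hv: "h v = v" using h by (auto simp: stab_def)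
    let ?d = "d n" and ?D = "(norm (f n v - v))\<^sup>2"
    obtain l where l: "l \<in> K" "\<forall>x y. x \<bullet> f n y = blinfun_apply l x \<bullet> y" "\<forall>x. blinfun_apply l (f n x) = x"
        "\<forall>x. blinfun_apply (f n) (l x) = x"
      using inverse_apply_K[OF f(1)] by blast
    have "(v + ?d *\<^sub>R p) \<bullet> (h o\<^sub>L l) (f n (v + ?d *\<^sub>R y)) \<le> (v + ?d *\<^sub>R p) \<bullet> f n (v + ?d *\<^sub>R y)"
      using f(3) compose_K[OF hK l(1)] unfolding maximal_pair_def by blast
    then have le: "(v + ?d *\<^sub>R p) \<bullet> h (v + ?d *\<^sub>R y) \<le> (v + ?d *\<^sub>R p) \<bullet> f n (v + ?d *\<^sub>R y)"
      using l(3) by simp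
    have "v \<bullet> h y = v \<bullet> y" using inner_K[OF hK, of v y] hv by simp
    then have lhs: "(v + ?d *\<^sub>R p) \<bullet> h (v + ?d *\<^sub>R y) =
        v \<bullet> v + ?d * (p \<bullet> v) + ?d * (v \<bullet> y) + ?d\<^sup>2 * (p \<bullet> h y)"
      by (simp add: blinfun.add_right blinfun.scaleR_right hv inner_add power2_eq_square algebra_simps)
    have rhs: "(v + ?d *\<^sub>R p) \<bullet> f n (v + ?d *\<^sub>R y) =
        v \<bullet> f n v + ?d * (p \<bullet> f n v) + ?d * (v \<bullet> f n y) + ?d\<^sup>2 * (p \<bullet> f n y)"
      by (simp add: blinfun.add_right blinfun.scaleR_right inner_add power2_eq_square algebra_simps)
    have 1: "v \<bullet> f n v = v \<bullet> v - ?D / 2"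
      using displacement_inner[OF f(1), of n v] by (simp add: inner_diff inner_commute)
    have 2: "p \<bullet> f n v \<le> p \<bullet> v + C * ?D"
      using CC(1)[OF f(1), of n] by (simp add: inner_diff inner_commute)
    have 3: "v \<bullet> f n y \<le> v \<bullet> y + C * ?D"
    proof -
      have "norm (l v - v) = norm (f n (l v - v))" by (simp add: norm_apply_K f(1))
      also have "f n (l v - v) = - (f n v - v)" using l(4) by (simp add: blinfun.diff_right)
      finally have "norm (l v - v) = norm (f n v - v)" by (simp only: norm_minus_cancel)
      then show ?thesis using CC(2)[OF l(1)] l(2) by (simp add: inner_diff)
    qed
    have "?d * (p \<bullet> f n v) \<le> ?d * (p \<bullet> v) + ?d * C * ?D"
      using mult_left_mono[OF 2, of ?d] d_pos[of n] by (simp add: algebra_simps)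
    moreover have "?d * (v \<bullet> f n y) \<le> ?d * (v \<bullet> y) + ?d * C * ?D"
      using mult_left_mono[OF 3, of ?d] d_pos[of n] by (simp add: algebra_simps)
    moreover have "2 * C * ?d * ?D \<le> 1/4 * ?D" by (intro mult_right_mono d_C) simp
    ultimately have "?D / 4 \<le> ?d\<^sup>2 * (p \<bullet> f n y) - ?d\<^sup>2 * (p \<bullet> h y)"
      using le unfolding lhs rhs 1 by (simp add: algebra_simps)
    then show ?thesis by (simp add: algebra_simps)
  qed
  obtain k r where k: "k \<in> K" "strict_mono r" "(f \<circ> r) \<longlonglongrightarrow> k"
    using compact_K f(1) unfolding compact_def by blast
  have limf: "(\<lambda>n. f (r n)) \<longlonglongrightarrow> k" using k(3) by (simp add: o_def)
  have limd: "(\<lambda>n. d (r n)) \<longlonglongrightarrow> 0" using LIMSEQ_subseq_LIMSEQ[OF lim_d k(2)] by (simp add: o_def)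
  have id_stab: "id_blinfun \<in> stab v" using id_K by (simp add: stab_def)
  have "(norm (k v - v))\<^sup>2 \<le> 4 * 0\<^sup>2 * (p \<bullet> k y - p \<bullet> id_blinfun y)"
  proof (rule tendsto_le[OF sequentially_bot])
    show "(\<lambda>n. 4 * (d (r n))\<^sup>2 * (p \<bullet> f (r n) y - p \<bullet> id_blinfun y))
        \<longlonglongrightarrow> 4 * 0\<^sup>2 * (p \<bullet> k y - p \<bullet> id_blinfun y)"
      by (intro tendsto_intros limd limf)
    show "(\<lambda>n. (norm (f (r n) v - v))\<^sup>2) \<longlonglongrightarrow> (norm (k v - v))\<^sup>2"
      by (intro tendsto_intros limf)
  qed (use key[OF id_stab] in \<open>intro always_eventually allI\<close>)
  then have k_stab: "k \<in> stab v" using k(1) by (simp add: stab_def)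
  have max: "p \<bullet> h y \<le> p \<bullet> k y" if h: "h \<in> stab v" for h
  proof (rule tendsto_le[OF sequentially_bot _ tendsto_const])
    show "(\<lambda>n. p \<bullet> f (r n) y) \<longlonglongrightarrow> p \<bullet> k y" by (intro tendsto_intros limf)
    have "p \<bullet> h y \<le> p \<bullet> f n y" for n
    proof -
      have "0 \<le> 4 * (d n)\<^sup>2 * (p \<bullet> f n y - p \<bullet> h y)" using key[OF h] zero_le_power2 order_trans by blast
      then show ?thesis using d_pos[of n] by (simp add: zero_le_mult_iff)
    qed
    then show "\<forall>\<^sub>F n in sequentially. p \<bullet> h y \<le> p \<bullet> f (r n) y" by simp
  qed
  \<comment> \<open>With the limit \<open>k\<close> itself in the role of \<open>h\<close>, the
    bound of \<open>key\<close> tends to 0 even after division by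
    \<open>(d n)\<^sup>2\<close>.\<close>
  have lim0: "(\<lambda>n. (1 / d (r n)) *\<^sub>R (f (r n) v - v)) \<longlonglongrightarrow> 0"
  proof -
    have "(\<lambda>n. 4 * (p \<bullet> f (r n) y - p \<bullet> k y)) \<longlonglongrightarrow> 4 * (p \<bullet> k y - p \<bullet> k y)"
      by (intro tendsto_intros limf)
    from tendsto_real_sqrt[OF this]
    have lim_sqrt: "(\<lambda>n. sqrt (4 * (p \<bullet> f (r n) y - p \<bullet> k y))) \<longlonglongrightarrow> 0" by simp
    have "norm ((1 / d n) *\<^sub>R (f n v - v)) \<le> sqrt (4 * (p \<bullet> f n y - p \<bullet> k y))" for n
    proof (rule real_le_rsqrt)
      have "(norm ((1 / d n) *\<^sub>R (f n v - v)))\<^sup>2 = (norm (f n v - v))\<^sup>2 / (d n)\<^sup>2"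
        by (simp add: power_divide)
      also have "\<dots> \<le> 4 * (p \<bullet> f n y - p \<bullet> k y)"
        using divide_right_mono[OF key[OF k_stab, of n], of "(d n)\<^sup>2"] d_pos[of n] by simp
      finally show "(norm ((1 / d n) *\<^sub>R (f n v - v)))\<^sup>2 \<le> 4 * (p \<bullet> f n y - p \<bullet> k y)" .
    qed
    then show ?thesis by (intro Lim_null_comparison[OF always_eventually lim_sqrt] allI)
  qed
  have lim: "(\<lambda>n. (1 / d (r n)) *\<^sub>R (f (r n) v - v) + f (r n) y) \<longlonglongrightarrow> 0 + k y"
    by (intro tendsto_intros lim0 limf)
  \<comment> \<open>Subtracting \<open>v\<close> and rescaling stays in \<Sigma>; in the limit the
    first summand vanishes and only \<open>k y\<close> is left.\<close>
  have mem: "(1 / d (r n)) *\<^sub>R (f (r n) v - v) + f (r n) y \<in> \<Sigma>" for n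
  proof -
    have "(1 / d (r n)) *\<^sub>R (f (r n) (v + d (r n) *\<^sub>R y) - v) \<in> \<Sigma>"
      using v f(2) by (intro subspace_scale subspace_diff subspace_\<Sigma>) auto
    also have "(1 / d (r n)) *\<^sub>R (f (r n) (v + d (r n) *\<^sub>R y) - v) =
        (1 / d (r n)) *\<^sub>R (f (r n) v - v) + f (r n) y"
      using d_pos[of "r n"] by (simp add: blinfun.add_right blinfun.scaleR_right algebra_simps)
    finally show ?thesis .
  qed
  have "k y \<in> \<Sigma>"
    using closed_sequentially[OF closed_subspace[OF subspace_\<Sigma>] mem lim] by simp
  then show ?thesis using k_stab max by blast
qed

lemma orbit_reduction_stab:
  assumes v: "v \<in> \<Sigma> \<inter> W"
  shows "orbit_reduction (stab v) \<Sigma> (W \<inter> orbit_normal v)"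
proof -
  interpret stab: compact_orthogonal_group "stab v" by (rule compact_orthogonal_group_stab)
  show ?thesis
  proof
    show "subspace \<Sigma>" by (rule subspace_\<Sigma>)
    show "subspace (W \<inter> orbit_normal v)" by (intro subspace_inter subspace_W subspace_orbit_normal)
    show "k x \<in> W \<inter> orbit_normal v" if "k \<in> stab v" "x \<in> W \<inter> orbit_normal v" for k x
      using that orbit_normal_apply invariant_W by (auto simp: stab_def)
    show "orthogonal_projection \<Sigma> y \<in> convex hull ((\<lambda>k. blinfun_apply k y) ` stab v)"
      if "y \<in> W \<inter> orbit_normal v" for y
      using v that
      by (intro projection_in_stab_hull subspace_\<Sigma> projection_in_hull)
        (auto intro: subspace_add subspace_scale subspace_W)
    show "\<exists>k\<in>stab v. k y \<in> \<Sigma> \<and> stab.maximal_pair p (k y)"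
      if p: "p \<in> \<Sigma> \<inter> (W \<inter> orbit_normal v)" and y: "y \<in> W \<inter> orbit_normal v" for p y
    proof -
      obtain k where k: "k \<in> stab v" "k y \<in> \<Sigma>" "\<And>h. h \<in> stab v \<Longrightarrow> p \<bullet> h y \<le> p \<bullet> k y"
        using stab_maximizer[OF v p y] by blast
      have "p \<bullet> h (k y) \<le> p \<bullet> k y" if "h \<in> stab v" for h
        using k(3)[OF stab.compose_K[OF that k(1)]] by simp
      then show ?thesis using k(1,2) by (auto simp: stab.maximal_pair_def)
    qed
  qed
qed

lemma projection_in_invariant:
  assumes "convex E" "E \<subseteq> W" "\<And>k. k \<in> K \<Longrightarrow> blinfun_apply k ` E = E" "x \<in> E"
  shows "orthogonal_projection \<Sigma> x \<in> E"
proof -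
  have "convex hull ((\<lambda>k. blinfun_apply k x) ` K) \<subseteq> E"
    using assms by (intro hull_minimal) auto
  then show ?thesis using projection_in_hull assms(2,4) by blast
qed

end

section \<open>Faces\<close>

lemma face_of_isometry_image_iff:
  "orthogonal_transformation f \<Longrightarrow> (f ` F) face_of (f ` E) \<longleftrightarrow> F face_of E"
  by (simp add: face_of_linear_image orthogonal_transformation_inj orthogonal_transformation_linear)

text \<open>
  A proper face lies in an exposed face of lower dimension, whose normal vector can be moved to
  \<open>\<Sigma>\<close>; this exposed face is invariant under the isotropy group of the normal vector.
\<close>

lemma face_aligned_with_section:
  assumes "orbit_reduction K \<Sigma> W" "compact E" "convex E" "E \<subseteq> W"
    "\<And>k. k \<in> K \<Longrightarrow> blinfun_apply k ` E = E" "F face_of E"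
  shows "\<exists>k\<in>K. (\<forall>x\<in>E. x \<in> blinfun_apply k ` F \<longleftrightarrow> orthogonal_projection \<Sigma> x \<in> blinfun_apply k ` F) \<and>
    (\<forall>y\<in>blinfun_apply k ` F. \<exists>h\<in>K. blinfun_apply h y \<in> blinfun_apply k ` F \<inter> \<Sigma>)"
  using assms
\<comment> \<open>The shift by 1 is needed because the empty set has affine dimension -1.\<close>
proof (induction "nat (aff_dim E + 1)" arbitrary: K W E F rule: less_induct)
  case less
  interpret orbit_reduction K \<Sigma> W by (rule less.prems(1))
  let ?\<sigma> = "orthogonal_projection \<Sigma>"
  have FE: "F \<subseteq> E" using less.prems(6) by (rule face_of_imp_subset)
  consider "F = {}" | "F = E" | "F \<noteq> {}" "F \<noteq> E" by blast
  then show ?case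
  proof cases
    case 1
    then show ?thesis using id_K by blast
  next
    case 2
    have "\<exists>h\<in>K. h y \<in> E \<inter> \<Sigma>" if y: "y \<in> E" for y
    proof -
      have "0 \<in> \<Sigma> \<inter> W" using subspace_\<Sigma> subspace_W by (simp add: subspace_0)
      then obtain h where "h \<in> K" "h y \<in> \<Sigma>" using maximizer[of 0 y] y less.prems(4) by blast
      then show ?thesis using less.prems(5) y by blast
    qed
    then show ?thesis
      using 2 id_K projection_in_invariant[OF less.prems(3-5)] by (intro bexI[of _ id_blinfun]) auto
  next
    case 3
    obtain x where x: "x \<in> rel_interior F"
      using 3(1) rel_interior_eq_empty[OF face_of_imp_convex[OF less.prems(6)]] by blast
    then have xF: "x \<in> F" using rel_interior_subset by blast
    have x_bd: "x \<notin> rel_interior E"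
    proof
      assume "x \<in> rel_interior E"
      then have "E \<subseteq> F" using xF by (intro subset_of_face_of[OF less.prems(6)]) auto
      then show False using 3(2) FE by blast
    qed
    have xE: "x \<in> E" using xF FE by blast
    obtain a where a: "\<forall>y\<in>E. a \<bullet> x \<le> a \<bullet> y" "\<forall>y\<in>rel_interior E. a \<bullet> x < a \<bullet> y"
      by (rule supporting_hyperplane_rel_boundary[OF less.prems(3) xE x_bd]) (rule that; blast)
    \<comment> \<open>Projecting to \<open>W\<close> keeps the values on \<open>E\<close> and gives
      a vector that can be moved within the reduction; the sign turns the minimum at
      \<open>x\<close> into a maximum.\<close>
    define w where "w = - orthogonal_projection W a"
    have w_W: "w \<in> W"
      unfolding w_def by (intro subspace_neg subspace_W orthogonal_projection_in)
    have w: "w \<bullet> y = - (a \<bullet> y)" if "y \<in> E" for y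
      using inner_orthogonal_projection[OF subspace_W, of y a] that less.prems(4)
      by (auto simp: w_def inner_commute)
    \<comment> \<open>Every point maximizes the functional 0, so here the maximizing property only
      serves to move \<open>w\<close> into \<Sigma>.\<close>
    have "0 \<in> \<Sigma> \<inter> W" using subspace_\<Sigma> subspace_W by (simp add: subspace_0)
    then obtain h where h: "h \<in> K" "h w \<in> \<Sigma>" using maximizer[OF _ w_W, of 0] by blast
    define v where "v = h w"
    have v: "v \<in> \<Sigma> \<inter> W" using h w_W invariant_W by (simp add: v_def)
    define b where "b = w \<bullet> x"
    define E' where "E' = E \<inter> {y. v \<bullet> y = b}"
    have hE: "h ` E = E" by (rule less.prems(5)[OF h(1)])
    have le: "v \<bullet> y \<le> b" if y: "y \<in> E" for y
    proof -
      obtain y' where y': "y' \<in> E" "y = h y'" using y hE by blast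
      then have "v \<bullet> y = w \<bullet> y'" by (simp add: v_def inner_K[OF h(1)])
      also have "\<dots> \<le> b" using w[OF y'(1)] w[OF xE] bspec[OF a(1) y'(1)] by (simp add: b_def)
      finally show ?thesis .
    qed
    have E'_face: "E' face_of E"
      unfolding E'_def using less.prems(3) le by (rule face_of_Int_supporting_hyperplane_le)
    have E'_sub: "E' \<subseteq> E" by (simp add: E'_def)
    have "E' \<noteq> E"
    proof
      assume eq: "E' = E"
      have "E \<noteq> {}" using xF FE by blast
      then obtain y where y: "y \<in> rel_interior E" using rel_interior_eq_empty[OF less.prems(3)] by blast
      then have yE: "y \<in> E" using rel_interior_subset by blast
      then have "h y \<in> E'" using eq hE by blast
      then have "w \<bullet> y = b" by (simp add: E'_def v_def inner_K[OF h(1)])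
      then show False using bspec[OF a(2) y] w[OF yE] w[OF xE] by (simp add: b_def)
    qed
    then have "aff_dim E' < aff_dim E" by (rule face_of_aff_dim_lt[OF less.prems(3) E'_face])
    then have dim: "nat (aff_dim E' + 1) < nat (aff_dim E + 1)"
      using aff_dim_geq[of E'] by linarith
    have hF_face: "h ` F face_of E"
      using face_of_isometry_image_iff[OF orthogonal_K[OF h(1)], of F E] less.prems(6) hE by simp
    have hF_sub: "h ` F \<subseteq> E'"
    proof (rule subset_of_face_of[OF E'_face])
      show "h ` F \<subseteq> E" using hF_face by (rule face_of_imp_subset)
      have "h x \<in> rel_interior (h ` F)"
        using x rel_interior_injective_linear_image[OF blinfun.bounded_linear_right,
            of h F] orthogonal_transformation_inj[OF orthogonal_K[OF h(1)]] by simp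
      moreover have "h x \<in> E'" using xF FE hE by (auto simp: E'_def v_def b_def inner_K[OF h(1)])
      ultimately show "E' \<inter> rel_interior (h ` F) \<noteq> {}" by blast
    qed
    then have hF_face': "h ` F face_of E'" using face_of_subset[OF hF_face _ E'_sub] by blast
    \<comment> \<open>All points of the exposed face maximize \<open>v\<close> on their orbits, so
      the face lies in the space on which the isotropy group of \<open>v\<close> has the inherited
      reduction.\<close>
    have normal: "y \<in> orbit_normal v" if y: "y \<in> E'" for y
    proof -
      have "maximal_pair v y" unfolding maximal_pair_def
      proof
        fix k assume "k \<in> K"
        then have "k y \<in> E" using less.prems(5) y E'_sub by blast
        then show "v \<bullet> k y \<le> v \<bullet> y" using le y by (simp add: E'_def)
      qed
      then show ?thesis using maximal_pair_commute maximal_pair_orbit_normal by blast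
    qed
    have inv: "k ` E' = E'" if k: "k \<in> stab v" for k
    proof -
      have kK: "k \<in> K" and kv: "k v = v" using k by (auto simp: stab_def)
      have "v \<bullet> k y = v \<bullet> y" for y using inner_K[OF kK, of v y] kv by simp
      then show ?thesis using less.prems(5)[OF kK] unfolding E'_def by force
    qed
    have "compact E'" using face_of_imp_compact[OF less.prems(3,2) E'_face] .
    moreover have "convex E'" using E'_face by (rule face_of_imp_convex)
    moreover have "E' \<subseteq> W \<inter> orbit_normal v" using normal E'_sub less.prems(4) by blast
    ultimately obtain k where k: "k \<in> stab v"
      "\<forall>x\<in>E'. x \<in> k ` h ` F \<longleftrightarrow> ?\<sigma> x \<in> k ` h ` F"
      "\<forall>y\<in>k ` h ` F. \<exists>g\<in>stab v. blinfun_apply g y \<in> k ` h ` F \<inter> \<Sigma>"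
      using less.hyps[OF dim orbit_reduction_stab[OF v] _ _ _ inv hF_face'] by blast
    have kK: "k \<in> K" using k(1) by (simp add: stab_def)
    have img: "(k o\<^sub>L h) ` F = k ` h ` F" by (auto simp: image_image)
    have sub: "k ` h ` F \<subseteq> E'" using hF_sub inv[OF k(1)] by blast
    have "x \<in> k ` h ` F \<longleftrightarrow> ?\<sigma> x \<in> k ` h ` F" if xE: "x \<in> E" for x
    proof (cases "x \<in> E'")
      case False
      \<comment> \<open>As \<open>v\<close> lies in \<Sigma>, projecting preserves its value and
        cannot carry a point of \<open>E\<close> into the exposed face from outside.\<close>
      have "v \<bullet> ?\<sigma> x = v \<bullet> x" using v by (intro inner_orthogonal_projection subspace_\<Sigma>) auto
      then have "?\<sigma> x \<notin> E'" using False xE by (simp add: E'_def)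
      then show ?thesis using False sub by blast
    qed (use k(2) in blast)
    moreover have "\<forall>y\<in>k ` h ` F. \<exists>g\<in>K. blinfun_apply g y \<in> k ` h ` F \<inter> \<Sigma>"
    proof -
      have "stab v \<subseteq> K" by (auto simp: stab_def)
      then show ?thesis using k(3) by blast
    qed
    ultimately show ?thesis
      using compose_K[OF kK h(1)] by (intro bexI[of _ "k o\<^sub>L h"]) (simp_all only: img, blast+)
  qed
qed

lemma face_of_linear_preimage:
  assumes "linear f" "Q face_of P" "f ` E \<subseteq> P" "convex E"
  shows "(f -` Q \<inter> E) face_of E"
  unfolding face_of_def
proof (intro conjI ballI impI)
  show "f -` Q \<inter> E \<subseteq> E" by blast
  show "convex (f -` Q \<inter> E)"
    using face_of_imp_convex[OF assms(2)] assms(1,4)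
    by (intro convex_Int convex_linear_vimage) auto
next
  fix a b x
  assume a: "a \<in> E" and b: "b \<in> E" and x: "x \<in> f -` Q \<inter> E" and seg: "x \<in> open_segment a b"
  obtain u where u: "0 < u" "u < 1" "x = (1 - u) *\<^sub>R a + u *\<^sub>R b" using seg by (auto simp: in_segment)
  have fx: "f x = (1 - u) *\<^sub>R f a + u *\<^sub>R f b"
    using u(3) assms(1) by (simp add: linear_add linear_scale)
  \<comment> \<open>If the two images coincide, their open segment is empty and the face property
    says nothing, but then both equal \<open>f x\<close>.\<close>
  have "f a \<in> Q \<and> f b \<in> Q"
  proof (cases "f a = f b")
    case True
    then have "f x = f a" using fx by (simp add: algebra_simps)
    then show ?thesis using x True by auto
  next
    case False
    then have "f x \<in> open_segment (f a) (f b)" using fx u by (auto simp: in_segment)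
    then show ?thesis using assms(2,3) a b x unfolding face_of_def by blast
  qed
  then show "a \<in> f -` Q \<inter> E" "b \<in> f -` Q \<inter> E" using a b by auto
qed

section \<open>Lifts of faces of the section\<close>

context fat_subspace
begin

text \<open>An isometry preserving \<Sigma> also preserves its orthogonal complement and therefore
  commutes with the projection.\<close>

lemma lifted_face_normalizer:
  assumes k: "k \<in> K" "blinfun_apply k ` \<Sigma> = \<Sigma>" and E: "blinfun_apply k ` E = E"
  shows "lifted_face \<Sigma> E (blinfun_apply k ` Q) = blinfun_apply k ` lifted_face \<Sigma> E Q"
proof -
  let ?\<sigma> = "orthogonal_projection \<Sigma>"
  have inj: "inj (blinfun_apply k)" by (rule orthogonal_transformation_inj[OF orthogonal_K[OF k(1)]])
  have comm: "?\<sigma> (k x) = k (?\<sigma> x)" for x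
  proof (rule orthogonal_projection_eqI[OF subspace_\<Sigma>])
    show "k (?\<sigma> x) \<in> \<Sigma>" using k(2) orthogonal_projection_in[OF subspace_\<Sigma>] by blast
    have "y \<bullet> (k x - k (?\<sigma> x)) = 0" if y: "y \<in> \<Sigma>" for y
    proof -
      obtain y' where y': "y' \<in> \<Sigma>" "y = k y'" using y k(2) by blast
      then have "y \<bullet> (k x - k (?\<sigma> x)) = y' \<bullet> (x - ?\<sigma> x)"
        by (simp add: inner_diff_right inner_K[OF k(1)])
      then show ?thesis using inner_orthogonal_projection[OF subspace_\<Sigma> y'(1), of x]
        by (simp add: inner_diff_right)
    qed
    then show "k x - k (?\<sigma> x) \<in> orthogonal_comp \<Sigma>" by (simp add: orthogonal_comp_def orthogonal_def)
  qed
  have "k x \<in> E \<longleftrightarrow> x \<in> E" for x using inj_image_mem_iff[OF inj, of x E] E by simp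
  then have "k x \<in> lifted_face \<Sigma> E (k ` Q) \<longleftrightarrow> x \<in> lifted_face \<Sigma> E Q" for x
    by (simp add: lifted_face_def comm inj_image_mem_iff[OF inj])
  moreover have "lifted_face \<Sigma> E (k ` Q) \<subseteq> k ` E" using E by (auto simp: lifted_face_def)
  moreover have "lifted_face \<Sigma> E Q \<subseteq> E" by (auto simp: lifted_face_def)
  ultimately show ?thesis by blast
qed

context
  fixes E :: "'v set"
  assumes compact_E: "compact E" and convex_E: "convex E"
    and invariant_E: "\<And>k. k \<in> K \<Longrightarrow> blinfun_apply k ` E = E"
begin

lemma projection_eq_section: "orthogonal_projection \<Sigma> ` E = E \<inter> \<Sigma>"
proof -
  interpret orbit_reduction K \<Sigma> UNIV by (rule orbit_reduction_UNIV)
  have "orthogonal_projection \<Sigma> x \<in> E" if "x \<in> E" for x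
    using projection_in_invariant[OF convex_E _ invariant_E that] by blast
  then show ?thesis
    using orthogonal_projection_in[OF subspace_\<Sigma>] orthogonal_projection_id[OF subspace_\<Sigma>]
    by (force intro: image_eqI[OF sym])
qed

lemma lifted_face_face_of: "Q face_of E \<inter> \<Sigma> \<Longrightarrow> lifted_face \<Sigma> E Q face_of E"
  unfolding lifted_face_def
  by (rule face_of_linear_preimage[OF linear_orthogonal_projection[OF subspace_\<Sigma>]])
    (use projection_eq_section convex_E in auto)

lemma lifted_face_Int:
  assumes "Q face_of E \<inter> \<Sigma>"
  shows "lifted_face \<Sigma> E Q \<inter> \<Sigma> = Q"
  using face_of_imp_subset[OF assms] orthogonal_projection_id[OF subspace_\<Sigma>]
  by (auto simp: lifted_face_def)

text \<open>After alignment, membership in the moved face is decided by the projection, so the face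
  is the lift of its own intersection with \<Sigma>.\<close>

lemma face_conjugate_to_lifted_face:
  assumes "F face_of E"
  shows "\<exists>k\<in>K. \<exists>Q. Q face_of E \<inter> \<Sigma> \<and> blinfun_apply k ` F = lifted_face \<Sigma> E Q \<and>
    (\<forall>y\<in>lifted_face \<Sigma> E Q. \<exists>h\<in>K. blinfun_apply h y \<in> Q)"
proof -
  obtain k where k: "k \<in> K"
    "\<forall>x\<in>E. x \<in> k ` F \<longleftrightarrow> orthogonal_projection \<Sigma> x \<in> k ` F"
    "\<forall>y\<in>k ` F. \<exists>h\<in>K. blinfun_apply h y \<in> k ` F \<inter> \<Sigma>"
    using face_aligned_with_section[OF orbit_reduction_UNIV compact_E convex_E subset_UNIV invariant_E assms]
    by blast
  have kF: "k ` F face_of E"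
    using face_of_isometry_image_iff[OF orthogonal_K[OF k(1)], of F E] assms invariant_E[OF k(1)] by simp
  have "k ` F \<inter> \<Sigma> face_of E \<inter> \<Sigma>"
    using face_of_Int_Int[OF kF face_of_refl] subspace_imp_convex[OF subspace_\<Sigma>] by blast
  moreover have "k ` F = lifted_face \<Sigma> E (k ` F \<inter> \<Sigma>)"
    using k(2) face_of_imp_subset[OF kF] orthogonal_projection_in[OF subspace_\<Sigma>]
    unfolding lifted_face_def vimage_def by blast
  ultimately show ?thesis using k(1,3) by metis
qed

text \<open>
  A relative interior point of \<open>Q\<close> is moved into \<open>Q\<^sub>0\<close> first by \<open>K\<close> and hence by the normalizer of
  \<open>\<Sigma>\<close>, which gives one inclusion between the lifted faces; they have the same dimension.
\<close>

lemma lifted_faces_conjugate: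
  assumes Q: "Q face_of E \<inter> \<Sigma>" and Q0: "Q0 face_of E \<inter> \<Sigma>"
    and g: "g \<in> K" "blinfun_apply g ` lifted_face \<Sigma> E Q = lifted_face \<Sigma> E Q0"
    and meets: "\<forall>y\<in>lifted_face \<Sigma> E Q0. \<exists>h\<in>K. blinfun_apply h y \<in> Q0"
  shows "\<exists>k\<in>K. blinfun_apply k ` \<Sigma> = \<Sigma> \<and> blinfun_apply k ` Q = Q0"
proof (cases "Q = {}")
  case True
  then have "lifted_face \<Sigma> E Q0 = {}" using g(2) by (auto simp: lifted_face_def)
  then have "Q0 = {}" using lifted_face_Int[OF Q0] by blast
  then show ?thesis using True id_K by (intro bexI[of _ id_blinfun]) auto
next
  case False
  let ?L = "lifted_face \<Sigma> E"
  obtain x where x: "x \<in> rel_interior Q"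
    using False rel_interior_eq_empty[OF face_of_imp_convex[OF Q]] by blast
  then have xQ: "x \<in> Q" using rel_interior_subset by blast
  have x_\<Sigma>: "x \<in> \<Sigma>" using xQ face_of_imp_subset[OF Q] by blast
  have "x \<in> ?L Q" using xQ lifted_face_Int[OF Q] by blast
  then have "g x \<in> ?L Q0" using g(2) by blast
  then obtain h where h: "h \<in> K" "h (g x) \<in> Q0" using meets by blast
  have "(h o\<^sub>L g) x \<in> \<Sigma>" using h(2) face_of_imp_subset[OF Q0] by auto
  then obtain k where k: "k \<in> K" "k ` \<Sigma> = \<Sigma>" "k x = (h o\<^sub>L g) x"
    using orbit_meets_\<Sigma>_in_normalizer_orbit[OF x_\<Sigma> compose_K[OF h(1) g(1)]] by blast
  have inj: "inj (blinfun_apply l)" if "l \<in> K" for l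
    by (rule orthogonal_transformation_inj[OF orthogonal_K[OF that]])
  have "k ` Q \<subseteq> Q0"
  proof (rule subset_of_face_of[OF Q0])
    show "k ` Q \<subseteq> E \<inter> \<Sigma>" using face_of_imp_subset[OF Q] k(2) invariant_E[OF k(1)] by blast
    have "k x \<in> rel_interior (k ` Q)"
      using x rel_interior_injective_linear_image[OF blinfun.bounded_linear_right, of k Q] inj[OF k(1)]
      by simp
    moreover have "k x \<in> Q0" using h(2) k(3) by simp
    ultimately show "Q0 \<inter> rel_interior (k ` Q) \<noteq> {}" by blast
  qed
  then have sub: "?L (k ` Q) \<subseteq> ?L Q0" by (auto simp: lifted_face_def)
  have eq: "?L (k ` Q) = k ` ?L Q" by (rule lifted_face_normalizer[OF k(1,2) invariant_E[OF k(1)]])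
  have Lk_face: "k ` ?L Q face_of E"
    using face_of_isometry_image_iff[OF orthogonal_K[OF k(1)], of "?L Q" E]
      lifted_face_face_of[OF Q] invariant_E[OF k(1)] by simp
  have Q0_face: "?L Q0 face_of E" by (rule lifted_face_face_of[OF Q0])
  have "k ` ?L Q face_of ?L Q0"
    using face_of_subset[OF Lk_face] sub eq face_of_imp_subset[OF Q0_face] by metis
  moreover have "aff_dim (k ` ?L Q) = aff_dim (?L Q0)"
    using aff_dim_injective_linear_image[OF linear_blinfun_apply inj[OF k(1)]]
      aff_dim_injective_linear_image[OF linear_blinfun_apply inj[OF g(1)]] g(2) by metis
  ultimately have "k ` ?L Q = ?L Q0"
    using face_of_aff_dim_lt[OF face_of_imp_convex[OF Q0_face]] by (metis less_irrefl)
  moreover have "?L (k ` Q) \<inter> \<Sigma> = k ` Q"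
  proof -
    have "k ` Q \<subseteq> E \<inter> \<Sigma>" using face_of_imp_subset[OF Q] k(2) invariant_E[OF k(1)] by blast
    then show ?thesis using orthogonal_projection_id[OF subspace_\<Sigma>] by (auto simp: lifted_face_def)
  qed
  ultimately have "k ` Q = Q0" using eq lifted_face_Int[OF Q0] by simp
  then show ?thesis using k(1,2) by blast
qed

text \<open>The previous lemma requires of its target that every orbit meeting the lift meets the
  face below it, which is not given for \<open>R\<close>. An aligned face \<open>Q0\<close> has this
  property, and both \<open>Q\<close> and \<open>R\<close> are conjugate to it under the
  normalizer.\<close>

lemma lifted_face_conjugate_imp_normalizer_conjugate:
  assumes Q: "Q face_of E \<inter> \<Sigma>" and R: "R face_of E \<inter> \<Sigma>"
    and g: "g \<in> K" "blinfun_apply g ` lifted_face \<Sigma> E Q = lifted_face \<Sigma> E R"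
  shows "\<exists>k\<in>K. blinfun_apply k ` \<Sigma> = \<Sigma> \<and> blinfun_apply k ` Q = R"
proof -
  obtain k Q0 where k: "k \<in> K" and Q0: "Q0 face_of E \<inter> \<Sigma>"
    and kR: "k ` lifted_face \<Sigma> E R = lifted_face \<Sigma> E Q0"
    and meets: "\<forall>y\<in>lifted_face \<Sigma> E Q0. \<exists>h\<in>K. blinfun_apply h y \<in> Q0"
    using face_conjugate_to_lifted_face[OF lifted_face_face_of[OF R]] by metis
  obtain n where n: "n \<in> K" "n ` \<Sigma> = \<Sigma>" "n ` R = Q0"
    using lifted_faces_conjugate[OF R Q0 k kR meets] by blast
  have image_compose: "(a o\<^sub>L b) ` S = a ` b ` S" for a b :: "'v \<Rightarrow>\<^sub>L 'v" and S
    by (simp add: image_image)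
  have "(k o\<^sub>L g) ` lifted_face \<Sigma> E Q = lifted_face \<Sigma> E Q0"
    unfolding image_compose g(2) by (rule kR)
  then obtain m where m: "m \<in> K" "m ` \<Sigma> = \<Sigma>" "m ` Q = Q0"
    using lifted_faces_conjugate[OF Q Q0 compose_K[OF k g(1)] _ meets] by blast
  obtain l where l: "l \<in> K" "\<forall>x. blinfun_apply l (n x) = x" using inverse_apply_K[OF n(1)] by blast
  have ln: "l ` n ` S = S" for S using l(2) by (simp add: image_image)
  have "(l o\<^sub>L m) ` \<Sigma> = \<Sigma>" unfolding image_compose m(2) using ln[of \<Sigma>] n(2) by simp
  moreover have "(l o\<^sub>L m) ` Q = R" unfolding image_compose m(3) using ln[of R] n(3) by simp
  ultimately show ?thesis using compose_K[OF l(1) m(1)] by blast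
qed

end
end

section \<open>Orbits of faces\<close>

lemma image_orbit_eq_iff:
  fixes M :: "('v::real_normed_vector \<Rightarrow>\<^sub>L 'v) set"
  assumes id: "id_blinfun \<in> M"
    and compose: "\<And>k l. \<lbrakk>k \<in> M; l \<in> M\<rbrakk> \<Longrightarrow> k o\<^sub>L l \<in> M"
    and inverse: "\<And>k. k \<in> M \<Longrightarrow> \<exists>l\<in>M. l o\<^sub>L k = id_blinfun"
  shows "(\<lambda>k. blinfun_apply k ` A) ` M = (\<lambda>k. blinfun_apply k ` B) ` M \<longleftrightarrow>
    (\<exists>k\<in>M. blinfun_apply k ` A = B)"
proof
  assume "(\<lambda>k. blinfun_apply k ` A) ` M = (\<lambda>k. blinfun_apply k ` B) ` M"
  moreover have "B \<in> (\<lambda>k. blinfun_apply k ` B) ` M" using id by (intro image_eqI[of _ _ id_blinfun]) auto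
  ultimately have "B \<in> (\<lambda>k. blinfun_apply k ` A) ` M" by simp
  then show "\<exists>k\<in>M. blinfun_apply k ` A = B" by blast
next
  have sub: "(\<lambda>k. blinfun_apply k ` k0 ` A) ` M \<subseteq> (\<lambda>k. blinfun_apply k ` A) ` M" if "k0 \<in> M" for k0 A
  proof
    fix S assume "S \<in> (\<lambda>k. blinfun_apply k ` k0 ` A) ` M"
    then obtain k where k: "k \<in> M" "S = k ` k0 ` A" by blast
    have "S = (k o\<^sub>L k0) ` A" by (simp add: k(2) image_image)
    then show "S \<in> (\<lambda>k. blinfun_apply k ` A) ` M" using compose[OF k(1) that] by blast
  qed
  assume "\<exists>k\<in>M. blinfun_apply k ` A = B"
  then obtain k where k: "k \<in> M" "B = k ` A" by blast
  obtain l where l: "l \<in> M" "l o\<^sub>L k = id_blinfun" using inverse[OF k(1)] by blast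
  have "l (k x) = x" for x using arg_cong[OF l(2), of "\<lambda>f. f x"] by simp
  then have "A = l ` B" by (simp add: k(2) image_image)
  then show "(\<lambda>k. blinfun_apply k ` A) ` M = (\<lambda>k. blinfun_apply k ` B) ` M"
    using sub[OF k(1), of A] sub[OF l(1), of B] k(2) by auto
qed

lemma bij_betw_orbits:
  assumes maps: "\<And>x. x \<in> X \<Longrightarrow> f x \<in> Y"
    and eq_iff: "\<And>x y. \<lbrakk>x \<in> X; y \<in> X\<rbrakk> \<Longrightarrow>
      orbit G \<phi> x = orbit G \<phi> y \<longleftrightarrow> orbit H \<psi> (f x) = orbit H \<psi> (f y)"
    and onto: "\<And>y. y \<in> Y \<Longrightarrow> \<exists>x\<in>X. orbit H \<psi> (f x) = orbit H \<psi> y"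
  shows "\<exists>\<Phi>. bij_betw \<Phi> (orbits G X \<phi>) (orbits H Y \<psi>) \<and>
    (\<forall>x\<in>X. \<Phi> (orbit G \<phi> x) = orbit H \<psi> (f x))"
proof -
  define \<Phi> where "\<Phi> S = orbit H \<psi> (f (SOME x. x \<in> X \<and> orbit G \<phi> x = S))" for S
  have \<Phi>: "\<Phi> (orbit G \<phi> x) = orbit H \<psi> (f x)" if "x \<in> X" for x
  proof -
    let ?y = "SOME y. y \<in> X \<and> orbit G \<phi> y = orbit G \<phi> x"
    have "?y \<in> X \<and> orbit G \<phi> ?y = orbit G \<phi> x" by (rule someI[of _ x]) (use that in simp)
    then show ?thesis using eq_iff[of ?y x] that by (simp add: \<Phi>_def)
  qed
  have "bij_betw \<Phi> (orbits G X \<phi>) (orbits H Y \<psi>)"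
    unfolding bij_betw_def
  proof
    show "inj_on \<Phi> (orbits G X \<phi>)"
    proof (rule inj_onI)
      fix S S' assume "S \<in> orbits G X \<phi>" "S' \<in> orbits G X \<phi>" and eq: "\<Phi> S = \<Phi> S'"
      then obtain x y where "x \<in> X" "S = orbit G \<phi> x" "y \<in> X" "S' = orbit G \<phi> y"
        by (auto simp: orbits_def)
      then show "S = S'" using eq \<Phi> eq_iff by simp
    qed
    show "\<Phi> ` orbits G X \<phi> = orbits H Y \<psi>"
    proof
      show "\<Phi> ` orbits G X \<phi> \<subseteq> orbits H Y \<psi>" using \<Phi> maps by (auto simp: orbits_def)
      show "orbits H Y \<psi> \<subseteq> \<Phi> ` orbits G X \<phi>"
      proof
        fix S assume "S \<in> orbits H Y \<psi>"
        then obtain y where "y \<in> Y" "S = orbit H \<psi> y" by (auto simp: orbits_def)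
        then obtain x where "x \<in> X" "S = \<Phi> (orbit G \<phi> x)" using onto \<Phi> by metis
        then show "S \<in> \<Phi> ` orbits G X \<phi>" by (auto simp: orbits_def)
      qed
    qed
  qed
  then show ?thesis using \<Phi> by blast
qed

section \<open>From the representation of \<open>G\<close> to its group of orthogonal maps\<close>

lemma critical_in_normal_space:
  assumes "p \<in> S" "\<And>x. x \<in> S \<Longrightarrow> w \<bullet> x \<le> w \<bullet> p"
  shows "w \<in> normal_space S p"
  unfolding normal_space_def orthogonal_comp_def mem_Collect_eq
proof
  fix v assume "v \<in> tangent_space S p"
  then obtain c :: "nat \<Rightarrow> real \<Rightarrow> 'a" where
    c: "\<And>k t. (c k has_vector_derivative c (Suc k) t) (at t)" "\<And>t. c 0 t \<in> S" "c 0 0 = p" "c 1 0 = v"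
    by (auto simp: tangent_space_def)
  have "((\<lambda>t. w \<bullet> c 0 t) has_vector_derivative w \<bullet> c (Suc 0) 0) (at 0)"
    by (rule bounded_linear.has_vector_derivative[OF bounded_linear_inner_right c(1)])
  then have "((\<lambda>t. w \<bullet> c 0 t) has_real_derivative w \<bullet> v) (at 0)"
    using c(4) by (simp add: has_real_derivative_iff_has_vector_derivative)
  then have "w \<bullet> v = 0"
    \<comment> \<open>Along the whole curve \<open>w \<bullet> c 0 t\<close> is largest at
      \<open>t = 0\<close>, so the radius 1 of the neighbourhood is arbitrary.\<close>
    by (rule DERIV_local_max[of _ _ _ 1]) (use assms c in auto)
  then show "orthogonal v w" by (simp add: orthogonal_def inner_commute)
qed

lemma orthogonal_representation_apply:
  assumes "orthogonal_representation G T \<rho>"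
  shows "\<lbrakk>g \<in> carrier G; h \<in> carrier G\<rbrakk> \<Longrightarrow> \<rho> (g \<otimes>\<^bsub>G\<^esub> h) = \<rho> g o\<^sub>L \<rho> h"
    and "g \<in> carrier G \<Longrightarrow> orthogonal_transformation (act \<rho> g)"
  using assms by (auto simp: orthogonal_representation_def orthogonal_group_def hom_def)

lemma orthogonal_representation_one:
  assumes "orthogonal_representation G T \<rho>" "group G"
  shows "\<rho> \<one>\<^bsub>G\<^esub> = id_blinfun"
proof (rule blinfun_eqI)
  interpret group G by (rule assms(2))
  note \<rho> = orthogonal_representation_apply[OF assms(1)]
  fix x
  have "act \<rho> \<one>\<^bsub>G\<^esub> (act \<rho> \<one>\<^bsub>G\<^esub> x) = act \<rho> \<one>\<^bsub>G\<^esub> x"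
    using arg_cong[OF \<rho>(1)[OF one_closed one_closed], of "\<lambda>k. blinfun_apply k x"] by simp
  then show "act \<rho> \<one>\<^bsub>G\<^esub> x = id_blinfun x"
    using orthogonal_transformation_inj[OF \<rho>(2)[OF one_closed]] by (simp add: inj_eq)
qed

lemma compact_orthogonal_group_representation:
  assumes "compact_lie_group G T n A" "orthogonal_representation G T \<rho>"
  shows "compact_orthogonal_group (\<rho> ` carrier G)"
proof -
  have G: "group G" and T: "topspace T = carrier G" "compact_space T"
    using assms(1) by (auto simp: compact_lie_group_def lie_group_def)
  interpret group G by (rule G)
  note \<rho> = orthogonal_representation_apply[OF assms(2)]
  note one = orthogonal_representation_one[OF assms(2) G]
  show ?thesis
  proof
    have "compactin euclidean (\<rho> ` topspace T)"
      by (rule image_compactin[of T])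
        (use assms(2) T(2) in \<open>auto simp: orthogonal_representation_def compact_space_def\<close>)
    then show "compact (\<rho> ` carrier G)" using T(1) by simp
    show "id_blinfun \<in> \<rho> ` carrier G" using one by (metis one_closed image_eqI)
    show "k o\<^sub>L l \<in> \<rho> ` carrier G" if "k \<in> \<rho> ` carrier G" "l \<in> \<rho> ` carrier G" for k l
    proof -
      obtain g h where gh: "g \<in> carrier G" "h \<in> carrier G" "k = \<rho> g" "l = \<rho> h" using \<open>k \<in> _\<close> \<open>l \<in> _\<close> by blast
      then have "k o\<^sub>L l = \<rho> (g \<otimes>\<^bsub>G\<^esub> h)" by (simp add: \<rho>(1))
      then show ?thesis using m_closed[OF gh(1,2)] by blast
    qed
    show "orthogonal_transformation (blinfun_apply k)" if "k \<in> \<rho> ` carrier G" for k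
      using that \<rho>(2) by auto
    show "\<exists>l\<in>\<rho> ` carrier G. l o\<^sub>L k = id_blinfun \<and> k o\<^sub>L l = id_blinfun" if "k \<in> \<rho> ` carrier G" for k
    proof -
      obtain g where g: "g \<in> carrier G" "k = \<rho> g" using \<open>k \<in> _\<close> by blast
      have "\<rho> (inv\<^bsub>G\<^esub> g) o\<^sub>L k = id_blinfun" "k o\<^sub>L \<rho> (inv\<^bsub>G\<^esub> g) = id_blinfun"
        using g one \<rho>(1)[of "inv\<^bsub>G\<^esub> g" g] \<rho>(1)[of g "inv\<^bsub>G\<^esub> g"] by simp_all
      then show ?thesis using g(1) by blast
    qed
  qed
qed

lemma fat_subspace_representation:
  assumes "compact_lie_group G T n A" "orthogonal_representation G T \<rho>" "fat_section G \<rho> \<Sigma>"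
  shows "fat_subspace (\<rho> ` carrier G) \<Sigma>"
proof -
  have G: "group G" using assms(1) by (simp add: compact_lie_group_def lie_group_def)
  interpret group G by (rule G)
  interpret K: compact_orthogonal_group "\<rho> ` carrier G"
    by (rule compact_orthogonal_group_representation[OF assms(1,2)])
  note \<rho> = orthogonal_representation_apply[OF assms(2)]
  note one = orthogonal_representation_one[OF assms(2) G]
  have regular: "regular_point G \<rho> p" if p: "K.regular p" for p
    unfolding regular_point_def
  proof
    fix q
    obtain g where g: "g \<in> carrier G" "K.stab p \<subseteq> K.stab (act \<rho> g q)"
      using p by (auto simp: K.regular_def)
    \<comment> \<open>The conjugating element is the inverse of the one that moves
      \<open>q\<close>.\<close>
    have "inv\<^bsub>G\<^esub> g \<otimes>\<^bsub>G\<^esub> h \<otimes>\<^bsub>G\<^esub> inv\<^bsub>G\<^esub> (inv\<^bsub>G\<^esub> g) \<in> stabilizer G (act \<rho>) q" if h: "h \<in> stabilizer G (act \<rho>) p" for h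
    proof -
      have hG: "h \<in> carrier G" "\<rho> h \<in> K.stab p" using h by (auto simp: stabilizer_def K.stab_def)
      then have "act \<rho> h (act \<rho> g q) = act \<rho> g q" using g(2) by (auto simp: K.stab_def)
      moreover have "act \<rho> (inv\<^bsub>G\<^esub> g) (act \<rho> g q) = q"
        using arg_cong[OF \<rho>(1)[OF inv_closed[OF g(1)] g(1)], of "\<lambda>k. blinfun_apply k q"] g(1) one by simp
      ultimately have "act \<rho> (inv\<^bsub>G\<^esub> g \<otimes>\<^bsub>G\<^esub> h \<otimes>\<^bsub>G\<^esub> g) q = q" using \<rho>(1) g(1) hG(1) by simp
      then show ?thesis using g(1) hG(1) by (simp add: stabilizer_def)
    qed
    then show "\<exists>g\<in>carrier G. (\<lambda>h. g \<otimes>\<^bsub>G\<^esub> h \<otimes>\<^bsub>G\<^esub> inv\<^bsub>G\<^esub> g) ` stabilizer G (act \<rho>) p \<subseteq> stabilizer G (act \<rho>) q"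
      using inv_closed[OF g(1)] by blast
  qed
  show ?thesis
  proof
    show "subspace \<Sigma>" using assms(3) by (simp add: fat_section_def)
    show "\<exists>g\<in>\<rho> ` carrier G. blinfun_apply g x \<in> \<Sigma>" for x
      using assms(3) by (auto simp: fat_section_def orbit_def)
    show "w \<in> \<Sigma>" if p: "p \<in> \<Sigma>" "K.regular p" "K.maximal_pair w p" for p w
    proof -
      have "w \<in> normal_space (orbit G (act \<rho>) p) p"
      proof (rule critical_in_normal_space)
        show "p \<in> orbit G (act \<rho>) p" unfolding orbit_def using one by force
        show "w \<bullet> x \<le> w \<bullet> p" if "x \<in> orbit G (act \<rho>) p" for x
          using that p(3) by (auto simp: orbit_def K.maximal_pair_def)
      qed
      then show ?thesis using assms(3) p(1) regular[OF p(2)] unfolding fat_section_def by blast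
    qed
    show "blinfun_apply g ` \<Sigma> = \<Sigma>"
      if "p \<in> \<Sigma>" "K.regular p" "g \<in> \<rho> ` carrier G" "blinfun_apply g p \<in> \<Sigma>" for p g
      using assms(3) that(1,3,4) regular[OF that(2)] unfolding fat_section_def by blast
  qed
qed

lemma orbit_act_set: "orbit G (act_set \<rho>) F = (\<lambda>k. blinfun_apply k ` F) ` \<rho> ` carrier G"
  by (auto simp: orbit_def)

text \<open>The centralizer acts trivially on \<Sigma>, hence on the image of \<open>Q\<close>, so
  the union over a coset is a single image and the Weyl orbit is the orbit under the
  normalizer.\<close>

lemma orbit_fat_weyl_group:
  assumes "orthogonal_representation G T \<rho>" "group G" "Q \<subseteq> \<Sigma>"
  shows "orbit (fat_weyl_group G \<rho> \<Sigma>) (weyl_act_set \<rho>) Q =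
    (\<lambda>k. blinfun_apply k ` Q) ` {k \<in> \<rho> ` carrier G. blinfun_apply k ` \<Sigma> = \<Sigma>}"
proof -
  interpret group G by (rule assms(2))
  note \<rho> = orthogonal_representation_apply[OF assms(1)]
  note one = orthogonal_representation_one[OF assms(1,2)]
  let ?Z = "set_centralizer G \<rho> \<Sigma>" and ?N = "set_normalizer G \<rho> \<Sigma>"
  let ?coset = "\<lambda>g. ?Z #>\<^bsub>G\<lparr>carrier := ?N\<rparr>\<^esub> g"
  have coset: "weyl_act_set \<rho> (?coset g) Q = act_set \<rho> g Q" if g: "g \<in> ?N" for g
  proof -
    have gG: "g \<in> carrier G" "act_set \<rho> g \<Sigma> = \<Sigma>" using g by (auto simp: set_normalizer_def)
    have "act_set \<rho> (z \<otimes>\<^bsub>G\<^esub> g) Q = act_set \<rho> g Q" if z: "z \<in> ?Z" for z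
    proof -
      have "act \<rho> (z \<otimes>\<^bsub>G\<^esub> g) x = act \<rho> g x" if "x \<in> Q" for x
      proof -
        have "act \<rho> g x \<in> \<Sigma>" using that assms(3) gG(2) by blast
        then show ?thesis using z \<rho>(1)[of z g] gG(1) by (simp add: set_centralizer_def)
      qed
      then show ?thesis by simp
    qed
    moreover have "\<one>\<^bsub>G\<^esub> \<in> ?Z" by (simp add: set_centralizer_def one)
    moreover have "?coset g = (\<lambda>z. z \<otimes>\<^bsub>G\<^esub> g) ` ?Z" by (auto simp: r_coset_def)
    ultimately show ?thesis by (auto simp: weyl_act_set_def)
  qed
  have "carrier (fat_weyl_group G \<rho> \<Sigma>) = ?coset ` ?N"
    by (auto simp: fat_weyl_group_def FactGroup_def RCOSETS_def)
  then have "orbit (fat_weyl_group G \<rho> \<Sigma>) (weyl_act_set \<rho>) Q = (\<lambda>g. weyl_act_set \<rho> (?coset g) Q) ` ?N"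
    by (auto simp: orbit_def)
  also have "\<dots> = (\<lambda>g. act_set \<rho> g Q) ` ?N" using coset by (rule image_cong[OF refl])
  also have "\<dots> = (\<lambda>k. blinfun_apply k ` Q) ` {k \<in> \<rho> ` carrier G. blinfun_apply k ` \<Sigma> = \<Sigma>}"
    by (auto simp: set_normalizer_def)
  finally show ?thesis .
qed

theorem theorem1p1:
  fixes G :: "('g, 'm) monoid_scheme"
    and T :: "'g topology"
    and n :: nat
    and A :: "('g set \<times> ('g \<Rightarrow> nat \<Rightarrow> real)) set"
    and \<rho> :: "'g \<Rightarrow> 'v::euclidean_space \<Rightarrow>\<^sub>L 'v"
    and \<Sigma> E P :: "'v set"
  assumes "compact_lie_group G T n A"
    and "orthogonal_representation G T \<rho>"
    and "nontrivial_copolarity G \<rho>"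
    and "fat_section G \<rho> \<Sigma>"
    and "compact E" and "convex E"
    and "\<forall>g\<in>carrier G. act_set \<rho> g E = E"
    and "P = orthogonal_projection \<Sigma> ` E"
  shows "P = E \<inter> \<Sigma> \<and>
    (\<forall>Q\<in>faces P. lifted_face \<Sigma> E Q \<in> faces E) \<and>
    (\<exists>\<Phi>. bij_betw \<Phi>
           (orbits (fat_weyl_group G \<rho> \<Sigma>) (faces P) (weyl_act_set \<rho>))
           (orbits G (faces E) (act_set \<rho>)) \<and>
         (\<forall>Q\<in>faces P.
            \<Phi> (orbit (fat_weyl_group G \<rho> \<Sigma>) (weyl_act_set \<rho>) Q) =
            orbit G (act_set \<rho>) (lifted_face \<Sigma> E Q)))"
proof -
  let ?K = "\<rho> ` carrier G" and ?L = "lifted_face \<Sigma> E"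
  interpret K: fat_subspace ?K \<Sigma>
    by (rule fat_subspace_representation[OF assms(1,2,4)])
  have G: "group G" using assms(1) by (simp add: compact_lie_group_def lie_group_def)
  have invariant: "k ` E = E" if "k \<in> ?K" for k using assms(7) that by auto
  have P: "P = E \<inter> \<Sigma>"
    using K.projection_eq_section[OF assms(5,6) invariant] assms(8) by simp
  have faces: "?L Q \<in> faces E" if "Q \<in> faces P" for Q
    using K.lifted_face_face_of[OF assms(5,6) invariant, of Q] that P by (simp add: faces_def)
  let ?N = "{k \<in> ?K. blinfun_apply k ` \<Sigma> = \<Sigma>}"
  have K_inverse: "\<exists>l\<in>?K. l o\<^sub>L k = id_blinfun" if "k \<in> ?K" for k
    using K.inverse_K[OF that] by blast
  have N_id: "id_blinfun \<in> ?N" using K.id_K by simp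
  have N_compose: "k o\<^sub>L l \<in> ?N" if "k \<in> ?N" "l \<in> ?N" for k l
  proof -
    have "(k o\<^sub>L l) ` \<Sigma> = k ` l ` \<Sigma>" by (simp add: image_image)
    then show ?thesis using that K.compose_K by auto
  qed
  have N_inverse: "\<exists>l\<in>?N. l o\<^sub>L k = id_blinfun" if k: "k \<in> ?N" for k
  proof -
    have kK: "k \<in> ?K" "k ` \<Sigma> = \<Sigma>" using k by auto
    obtain l where l: "l \<in> ?K" "l o\<^sub>L k = id_blinfun" "\<forall>x. blinfun_apply l (k x) = x"
      using K.inverse_apply_K[OF kK(1)] by blast
    have "l ` k ` \<Sigma> = \<Sigma>" using l(3) by (simp add: image_image)
    then have "l ` \<Sigma> = \<Sigma>" by (simp only: kK(2))
    then show ?thesis using l(1,2) by blast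
  qed
  have eq_iff: "orbit (fat_weyl_group G \<rho> \<Sigma>) (weyl_act_set \<rho>) Q = orbit (fat_weyl_group G \<rho> \<Sigma>) (weyl_act_set \<rho>) R \<longleftrightarrow>
      orbit G (act_set \<rho>) (?L Q) = orbit G (act_set \<rho>) (?L R)"
    if QR: "Q \<in> faces P" "R \<in> faces P" for Q R
  proof -
    have Q: "Q face_of E \<inter> \<Sigma>" and R: "R face_of E \<inter> \<Sigma>" using QR P by (auto simp: faces_def)
    then have sub: "Q \<subseteq> \<Sigma>" "R \<subseteq> \<Sigma>" by (auto dest: face_of_imp_subset)
    have "orbit (fat_weyl_group G \<rho> \<Sigma>) (weyl_act_set \<rho>) Q = orbit (fat_weyl_group G \<rho> \<Sigma>) (weyl_act_set \<rho>) R \<longleftrightarrow>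
        (\<exists>k\<in>?N. blinfun_apply k ` Q = R)"
      unfolding orbit_fat_weyl_group[OF assms(2) G sub(1)] orbit_fat_weyl_group[OF assms(2) G sub(2)]
      by (rule image_orbit_eq_iff[OF N_id N_compose N_inverse])
    \<comment> \<open>The forward direction makes the map on orbits well defined, the converse makes
      it injective.\<close>
    also have "\<dots> \<longleftrightarrow> (\<exists>k\<in>?K. blinfun_apply k ` ?L Q = ?L R)"
    proof
      assume "\<exists>k\<in>?N. blinfun_apply k ` Q = R"
      then obtain k where k: "k \<in> ?K" "k ` \<Sigma> = \<Sigma>" "k ` Q = R" by blast
      have "k ` ?L Q = ?L R"
        using K.lifted_face_normalizer[OF k(1,2) invariant[OF k(1)], of Q] k(3) by simp
      then show "\<exists>k\<in>?K. blinfun_apply k ` ?L Q = ?L R" using k(1) by blast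
    next
      assume "\<exists>k\<in>?K. blinfun_apply k ` ?L Q = ?L R"
      then obtain k where k: "k \<in> ?K" "k ` ?L Q = ?L R" by blast
      show "\<exists>k\<in>?N. blinfun_apply k ` Q = R"
        using K.lifted_face_conjugate_imp_normalizer_conjugate[OF assms(5,6) invariant Q R k] by simp
    qed
    also have "\<dots> \<longleftrightarrow> orbit G (act_set \<rho>) (?L Q) = orbit G (act_set \<rho>) (?L R)"
      unfolding orbit_act_set
      by (rule image_orbit_eq_iff[OF K.id_K K.compose_K K_inverse, symmetric])
    finally show ?thesis .
  qed
  have onto: "\<exists>Q\<in>faces P. orbit G (act_set \<rho>) (?L Q) = orbit G (act_set \<rho>) F" if F: "F \<in> faces E" for F
  proof -
    obtain k Q where k: "k \<in> ?K" "Q face_of E \<inter> \<Sigma>" "k ` F = ?L Q"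
      using K.face_conjugate_to_lifted_face[OF assms(5,6) invariant, of F] F unfolding faces_def by blast
    have "\<exists>k\<in>?K. blinfun_apply k ` F = ?L Q" using k(1,3) by blast
    then have "orbit G (act_set \<rho>) F = orbit G (act_set \<rho>) (?L Q)"
      unfolding orbit_act_set using image_orbit_eq_iff[OF K.id_K K.compose_K K_inverse] by simp
    moreover have "Q \<in> faces P" using k(2) P by (simp add: faces_def)
    ultimately show ?thesis by (intro bexI[of _ Q]) simp_all
  qed
  show ?thesis
    by (intro conjI P ballI faces bij_betw_orbits eq_iff onto)
qed

end
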